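(* For all $m,n\in\mathbb{Z}_{>0}$ the following identities hold in the quantum cluster algebra $\mathcal{A}_q(Q)$ of type $A_2^{(1)}$ with principal coefficients: (1) $u_nX_m=q^{\frac{3n^2+2n}{2}}X_{m-2n}\,y_1^ny_2^ny_3^n+X_{m+2n}$ for $m\ge 2n+1$; (2) $u_nX_{2m-1}=q^{\frac{3m^2-4m+2}{2}}X_{2m-1-2n}\,y_1^my_2^{m-1}y_3^{m-1}+X_{2m-1+2n}$ for $1\le 2m-1\le 2n$; (3) $u_nX_{2m}=q^{\frac{3m^2-2m+1}{2}}X_{2m-2n}\,y_1^my_2^my_3^{m-1}+X_{2m+2n}$ for $1\le 2m\le 2n$; (4) $u_nX_{-m}=q^{\frac{3n^2-2n}{2}}X_{-m+2n}\,y_1^ny_2^ny_3^n+X_{-m-2n}$ for $m\ge 2n$; (5) $u_nX_{-(2m-1)}=q^{\frac{3m^2-2m-1}{2}}X_{-(2m-1)+2n}\,y_1^{m-1}y_2^my_3^m+X_{-(2m-1)-2n}$ for $0\le 2m-1\le 2n-1$; (6) $u_nX_{-(2m-2)}=q^{\frac{3m^2-4m}{2}}X_{-(2m-2)+2n}\,y_1^{m-1}y_2^{m-1}y_3^m+X_{-(2m-2)-2n}$ for $0\le 2m-2\le 2n-1$.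
   Context: Quantum torus. Let $q$ be a formal parameter and let $\Lambda$ be the skew-symmetric bilinear form on $\mathbb{Z}^6$ (standard basis $\mathbf e_1,\dots,\mathbf e_6$) with $\Lambda(\mathbf e_i,\mathbf e_j)=\lambda_{ij}$, where $$(\lambda_{ij})=\begin{pmatrix}0&0&0&-1&0&0\\0&0&0&0&-1&0\\0&0&0&0&0&-1\\1&0&0&0&-1&-1\\0&1&0&1&0&-1\\0&0&1&1&1&0\end{pmatrix},\qquad \widetilde B=\begin{pmatrix}0&1&1\\-1&0&1\\-1&-1&0\\1&0&0\\0&1&0\\0&0&1\end{pmatrix}.$$ The based quantum torus $\mathcal T$ is the $\mathbb{Z}[q^{\pm 1/2}]$-algebra with $\mathbb{Z}[q^{\pm 1/2}]$-basis $\{X^{\mathbf c}:\mathbf c\in\mathbb{Z}^6\}$ and multiplication $X^{\mathbf c}X^{\mathbf d}=q^{\Lambda(\mathbf c,\mathbf d)/2}X^{\mathbf c+\mathbf d}$; $\mathcal F$ is its skew-field of fractions. Put $X_i=X^{\mathbf e_i}$ for $i=1,2,3$ and $y_1=X^{\mathbf e_4}$, $y_2=X^{\mathbf e_5}$, $y_3=X^{\mathbf e_6}$. Seeds and mutation. A quantum seed is a triple $(\Lambda',\widetilde B',X')$ with $X'=(X_1',\dots,X_6')$ in $\mathcal F$, where $(X')^{\mathbf c}:=q^{-\frac12\sum_{i<j}c_ic_j\lambda'_{ij}}(X_1')^{c_1}\cdots (X_6')^{c_6}$. The mutation in direction $k\in\{1,2,3\}$ replaces $\Lambda'$ by $E^T\Lambda'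 E$, where $E=(e_{ij})$ has $e_{ij}=\delta_{ij}$ for $j\ne k$, $e_{kk}=-1$, $e_{ik}=[-b'_{ik}]_+$ for $i\ne k$ ($[a]_+=\max(a,0)$); replaces $b'_{ij}$ by $-b'_{ij}$ if $i=k$ or $j=k$, and by $b'_{ij}+\frac12(|b'_{ik}|b'_{kj}+b'_{ik}|b'_{kj}|)$ otherwise; and replaces $X'_k$ by $(X')^{-\mathbf e_k+\sum_i[b'_{ik}]_+\mathbf e_i}+(X')^{-\mathbf e_k+\sum_i[-b'_{ik}]_+\mathbf e_i}$, leaving the other $X'_j$ unchanged. The initial seed is $\Sigma_1=(\Lambda,\widetilde B,(X_1,X_2,X_3,y_1,y_2,y_3))$; $\mathcal A_q(Q)\subset\mathcal F$ is generated, over Laurent polynomials in $y_1,y_2,y_3$ with coefficients in $\mathbb{Z}[q^{\pm1/2}]$, by all quantum cluster variables (first three entries of $X'$ in seeds obtained from $\Sigma_1$ by finitely many mutations). Variables $X_m$, $m\in\mathbb{Z}$. The seed $\Sigma_m$ has cluster $(X_m,X_{m+1},X_{m+2})$: mutating $\Sigma_m$ in direction 1 replaces $X_m$ by $X_{m+3}$ and, after reordering the first three indices to $(X_{m+1},X_{m+2},X_{m+3})$, gives $\Sigma_{m+1}$; mutating $\Sigma_m$ in direction 3 replaces $X_{m+2}$ by $X_{m-1}$ and, after reordering to $(X_{m-1},X_m,X_{m+1})$, gives $\Sigma_{m-1}$. Elements $w,z,u_n$: $w=X^{(1,-1,0,0,1,0)}+X^{(0,-1,1,0,0,0)}$, $z=X^{(0,1,-1,1,0,1)}+X^{(-1,0,-1,1,0,0)}+X^{(-1,1,0,0,0,0)}$;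 $u_0=1$, $u_1=wz-q^{-1/2}X^{(0,0,0,1,0,1)}-q^{1/2}X^{(0,0,0,0,1,0)}$, $u_2=u_1^2-2X^{(0,0,0,1,1,1)}$, $u_{n+1}=u_1u_n-X^{(0,0,0,1,1,1)}u_{n-1}$ for $n\ge2$. *)

theory Defs
  imports "HOL-Analysis.Cartesian_Space"
    "HOL-Library.Poly_Mapping" "HOL-Library.Numeral_Type"
begin

section \<open>The based quantum torus\<close>

text \<open>
  All indices are 1-based as on paper. Matrices are functions of natural numbers, of which only the
  entries with row index in \<open>{1..6}\<close> and column index in \<open>{1..6}\<close> (resp. \<open>{1..3}\<close>) matter.
\<close>

definition lam :: "nat \<Rightarrow> nat \<Rightarrow> int" where
  "lam i j = [[0, 0, 0, -1,  0,  0],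
              [0, 0, 0,  0, -1,  0],
              [0, 0, 0,  0,  0, -1],
              [1, 0, 0,  0, -1, -1],
              [0, 1, 0,  1,  0, -1],
              [0, 0, 1,  1,  1,  0]] ! (i - 1) ! (j - 1)"

definition Btilde :: "nat \<Rightarrow> nat \<Rightarrow> int" where
  "Btilde i j = [[ 0,  1, 1],
                 [-1,  0, 1],
                 [-1, -1, 0],
                 [ 1,  0, 0],
                 [ 0,  1, 0],
                 [ 0,  0, 1]] ! (i - 1) ! (j - 1)"

text \<open>
  Elements of the lattice are of type \<^typ>\<open>int ^ 6\<close>. The index type \<^typ>\<open>6\<close> is the integers modulo 6;
  \<^term>\<open>of_nat i :: 6\<close> for \<open>i \<in> {1..6}\<close> enumerates it, the last index \<open>6\<close> being the same as \<open>0\<close>.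
\<close>

definition basis_vec :: "nat \<Rightarrow> int ^ 6" where
  "basis_vec i = axis (of_nat i) 1"

definition Lambda :: "int ^ 6 \<Rightarrow> int ^ 6 \<Rightarrow> int" where
  "Lambda c d = (\<Sum>i=1..6. \<Sum>j=1..6. c $ of_nat i * lam i j * d $ of_nat j)"

text \<open>
  \<open>QMon k c\<close> stands for \<open>q\<^sup>k\<^sup>/\<^sup>2 X\<^sup>c\<close>. These elements form a monoid (in fact a group) under
  multiplication, written additively below, and they are a basis of the quantum torus over the
  integers. So the quantum torus is the integral monoid ring \<open>qmon \<Rightarrow>\<^sub>0 int\<close>.
\<close>

datatype qmon = QMon int "int ^ 6"

lemma Lambda_zero [simp]: "Lambda 0 d = 0" "Lambda c 0 = 0"
  by (simp_all add: Lambda_def)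

lemma Lambda_add:
  "Lambda (c + c') d = Lambda c d + Lambda c' d"
  "Lambda c (d + d') = Lambda c d + Lambda c d'"
  by (simp_all add: Lambda_def algebra_simps sum.distrib)

instantiation qmon :: monoid_add
begin

definition zero_qmon :: qmon where
  "zero_qmon = QMon 0 0"

fun plus_qmon :: "qmon \<Rightarrow> qmon \<Rightarrow> qmon" where
  "plus_qmon (QMon k c) (QMon l d) = QMon (k + l + Lambda c d) (c + d)"

instance
proof
  fix a b c :: qmon
  show "a + b + c = a + (b + c)"
    by (cases a; cases b; cases c) (simp add: Lambda_add)
  show "0 + a = a" "a + 0 = a"
    by (cases a; simp add: zero_qmon_def)+
qed

end

type_synonym qtorus = "qmon \<Rightarrow>\<^sub>0 int"

definition qX :: "int ^ 6 \<Rightarrow> qtorus" where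
  "qX c = Poly_Mapping.single (QMon 0 c) 1"

text \<open>\<open>qhalf k\<close> is \<open>q\<^sup>k\<^sup>/\<^sup>2\<close>.\<close>

definition qhalf :: "int \<Rightarrow> qtorus" where
  "qhalf k = Poly_Mapping.single (QMon k 0) 1"

lemma qX_mult: "qX c * qX d = qhalf (Lambda c d) * qX (c + d)"
  by (simp add: qX_def qhalf_def mult_single)

lemma qX_zero: "qX 0 = 1"
  by (simp add: qX_def flip: zero_qmon_def)

lemma qhalf_zero: "qhalf 0 = 1"
  by (simp add: qhalf_def flip: zero_qmon_def)

lemma qhalf_add: "qhalf (k + l) = qhalf k * qhalf l"
  by (simp add: qhalf_def mult_single)

lemma qhalf_mult_qX: "qhalf k * qX c = Poly_Mapping.single (QMon k c) 1"
  by (simp add: qX_def qhalf_def mult_single)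

lemma qtorus_expand: "f = (\<Sum>m\<in>Poly_Mapping.keys f. Poly_Mapping.single m (Poly_Mapping.lookup f m))"
  for f :: qtorus
  by (rule poly_mapping_eqI)
     (auto simp: lookup_sum lookup_single when_def in_keys_iff intro: sum.neutral)

lemma qhalf_central: "qhalf k * f = f * qhalf k"
proof -
  have "qhalf k * Poly_Mapping.single m a = Poly_Mapping.single m a * qhalf k" for m a
    by (cases m) (simp add: qhalf_def mult_single add.commute)
  then show ?thesis
    by (subst (1 2) qtorus_expand) (simp add: sum_distrib_left sum_distrib_right)
qed

lemma vector6_nth:
  "map (\<lambda>i. (vector [a1, a2, a3, a4, a5, a6] :: int ^ 6) $ of_nat i) [1..<7] =
     [a1, a2, a3, a4, a5, a6]"
  by (simp add: vector_def upt_rec)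

lemma Lambda_basis_vec:
  assumes "i \<in> {1..6}" "j \<in> {1..6}"
  shows "Lambda (basis_vec i) (basis_vec j) = lam i j"
proof -
  have "inj_on (of_nat :: nat \<Rightarrow> 6) {1..6}"
  proof -
    have "{1..6} = {1, 2, 3, 4, 5, 6::nat}" by auto
    then show ?thesis by (simp add: inj_on_def)
  qed
  then have "basis_vec k $ of_nat l = (if l = k then 1 else 0)"
    if "k \<in> {1..6}" "l \<in> {1..6}" for k l
    using that by (auto simp: basis_vec_def axis_def inj_on_eq_iff)
  then have "Lambda (basis_vec i) (basis_vec j) =
      (\<Sum>k=1..6. \<Sum>l=1..6. (if k = i then 1 else 0) * lam k l * (if l = j then 1 else 0))"
    unfolding Lambda_def using assms by (intro sum.cong refl) simp
  also have "\<dots> = (\<Sum>k=1..6. if k = i then lam k j else 0)"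
    using assms by (intro sum.cong refl) (simp add: if_distrib cong: if_cong)
  also have "\<dots> = lam i j"
    using assms by simp
  finally show ?thesis .
qed

text \<open>
  \<open>skew_field_of_fractions \<iota>\<close>: the division ring \<open>'f\<close> is, through the embedding \<open>\<iota>\<close>, the skew-field
  of fractions of the quantum torus. The quantum torus is an Ore domain, so such an embedding exists
  and is unique up to unique isomorphism.
\<close>

definition skew_field_of_fractions :: "(qtorus \<Rightarrow> 'f::division_ring) \<Rightarrow> bool" where
  "skew_field_of_fractions \<iota> \<longleftrightarrow>
     inj \<iota> \<and> \<iota> 1 = 1 \<and>
     (\<forall>a b. \<iota> (a + b) = \<iota> a + \<iota> b) \<and>
     (\<forall>a b. \<iota> (a * b) = \<iota> a * \<iota> b) \<and>
     (\<forall>x. \<exists>a b. b \<noteq> 0 \<and> x = \<iota> a * inverse (\<iota> b))"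

section \<open>Quantum seeds and mutation\<close>

datatype 'f qseed =
  QSeed (form: "nat \<Rightarrow> nat \<Rightarrow> int") (exch: "nat \<Rightarrow> nat \<Rightarrow> int") (clus: "nat \<Rightarrow> 'f")

text \<open>\<open>toric v \<Lambda>' X' c\<close> is \<open>(X')\<^sup>c\<close>, where \<open>v\<close> is the square root of \<open>q\<close>.\<close>

definition toric ::
    "'f::division_ring \<Rightarrow> (nat \<Rightarrow> nat \<Rightarrow> int) \<Rightarrow> (nat \<Rightarrow> 'f) \<Rightarrow> (nat \<Rightarrow> int) \<Rightarrow> 'f" where
  "toric v L x c =
     v powi (- (\<Sum>j=1..6. \<Sum>i=1..<j. c i * c j * L i j)) *
     prod_list (map (\<lambda>i. x i powi c i) [1..<7])"

definition ppart :: "int \<Rightarrow> int" where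
  "ppart a = max a 0"

definition mut_E :: "(nat \<Rightarrow> nat \<Rightarrow> int) \<Rightarrow> nat \<Rightarrow> nat \<Rightarrow> nat \<Rightarrow> int" where
  "mut_E B k i j =
     (if j \<noteq> k then (if i = j then 1 else 0)
      else if i = k then -1 else ppart (- B i k))"

definition mut_form ::
    "(nat \<Rightarrow> nat \<Rightarrow> int) \<Rightarrow> (nat \<Rightarrow> nat \<Rightarrow> int) \<Rightarrow> nat \<Rightarrow> nat \<Rightarrow> nat \<Rightarrow> int" where
  "mut_form L B k i j = (\<Sum>r=1..6. \<Sum>s=1..6. mut_E B k r i * L r s * mut_E B k s j)"

text \<open>The numerator of the fraction below is always even, so \<open>div\<close> is exact.\<close>

definition mut_exch :: "(nat \<Rightarrow> nat \<Rightarrow> int) \<Rightarrow> nat \<Rightarrow> nat \<Rightarrow> nat \<Rightarrow> int" where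
  "mut_exch B k i j =
     (if i = k \<or> j = k then - B i j
      else B i j + (\<bar>B i k\<bar> * B k j + B i k * \<bar>B k j\<bar>) div 2)"

definition mut_clus ::
    "'f::division_ring \<Rightarrow> (nat \<Rightarrow> nat \<Rightarrow> int) \<Rightarrow> (nat \<Rightarrow> nat \<Rightarrow> int) \<Rightarrow> (nat \<Rightarrow> 'f) \<Rightarrow> nat \<Rightarrow> nat \<Rightarrow> 'f"
  where
  "mut_clus v L B x k =
     x(k := toric v L x (\<lambda>i. (if i = k then -1 else 0) + ppart (B i k)) +
            toric v L x (\<lambda>i. (if i = k then -1 else 0) + ppart (- B i k)))"

definition mutate :: "'f::division_ring \<Rightarrow> nat \<Rightarrow> 'f qseed \<Rightarrow> 'f qseed" where
  "mutate v k s =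
     QSeed (mut_form (form s) (exch s) k)
           (mut_exch (exch s) k)
           (mut_clus v (form s) (exch s) (clus s) k)"

definition sqrt_q :: "(qtorus \<Rightarrow> 'f::division_ring) \<Rightarrow> 'f" where
  "sqrt_q \<iota> = \<iota> (qhalf 1)"

definition yvar :: "(qtorus \<Rightarrow> 'f::division_ring) \<Rightarrow> nat \<Rightarrow> 'f" where
  "yvar \<iota> i = \<iota> (qX (basis_vec (3 + i)))"

text \<open>The cluster is \<open>(X\<^sub>1, X\<^sub>2, X\<^sub>3, y\<^sub>1, y\<^sub>2, y\<^sub>3)\<close>.\<close>

definition initial_seed :: "(qtorus \<Rightarrow> 'f::division_ring) \<Rightarrow> 'f qseed" where
  "initial_seed \<iota> = QSeed lam Btilde (\<lambda>i. \<iota> (qX (basis_vec i)))"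

inductive_set quantum_seeds :: "(qtorus \<Rightarrow> 'f::division_ring) \<Rightarrow> 'f qseed set"
  for \<iota> where
  initial: "initial_seed \<iota> \<in> quantum_seeds \<iota>"
| mutation: "s \<in> quantum_seeds \<iota> \<Longrightarrow> k \<in> {1, 2, 3} \<Longrightarrow> mutate (sqrt_q \<iota>) k s \<in> quantum_seeds \<iota>"

definition cluster_variables :: "(qtorus \<Rightarrow> 'f::division_ring) \<Rightarrow> 'f set" where
  "cluster_variables \<iota> = {clus s i | s i. s \<in> quantum_seeds \<iota> \<and> i \<in> {1, 2, 3}}"

inductive_set cluster_algebra :: "(qtorus \<Rightarrow> 'f::division_ring) \<Rightarrow> 'f set"
  for \<iota> where
  one: "1 \<in> cluster_algebra \<iota>"
| q: "sqrt_q \<iota> \<in> cluster_algebra \<iota>"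
| q_inv: "inverse (sqrt_q \<iota>) \<in> cluster_algebra \<iota>"
| y: "i \<in> {1, 2, 3} \<Longrightarrow> yvar \<iota> i \<in> cluster_algebra \<iota>"
| y_inv: "i \<in> {1, 2, 3} \<Longrightarrow> inverse (yvar \<iota> i) \<in> cluster_algebra \<iota>"
| var: "x \<in> cluster_variables \<iota> \<Longrightarrow> x \<in> cluster_algebra \<iota>"
| uminus: "a \<in> cluster_algebra \<iota> \<Longrightarrow> - a \<in> cluster_algebra \<iota>"
| add: "a \<in> cluster_algebra \<iota> \<Longrightarrow> b \<in> cluster_algebra \<iota> \<Longrightarrow> a + b \<in> cluster_algebra \<iota>"
| mult: "a \<in> cluster_algebra \<iota> \<Longrightarrow> b \<in> cluster_algebra \<iota> \<Longrightarrow> a * b \<in> cluster_algebra \<iota>"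

section \<open>The cluster variables \<open>X\<^sub>m\<close>\<close>

text \<open>Position \<open>i\<close> of the reordered seed is position \<open>p i\<close> of the old one.\<close>

definition reorder :: "(nat \<Rightarrow> nat) \<Rightarrow> 'f qseed \<Rightarrow> 'f qseed" where
  "reorder p s =
     QSeed (\<lambda>i j. form s (p i) (p j)) (\<lambda>i j. exch s (p i) (p j)) (\<lambda>i. clus s (p i))"

definition seed_up :: "'f::division_ring \<Rightarrow> 'f qseed \<Rightarrow> 'f qseed" where
  "seed_up v s = reorder (id(1 := 2, 2 := 3, 3 := 1)) (mutate v 1 s)"

definition seed_down :: "'f::division_ring \<Rightarrow> 'f qseed \<Rightarrow> 'f qseed" where
  "seed_down v s = reorder (id(1 := 3, 2 := 1, 3 := 2)) (mutate v 3 s)"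

definition Sigma_seed :: "(qtorus \<Rightarrow> 'f::division_ring) \<Rightarrow> int \<Rightarrow> 'f qseed" where
  "Sigma_seed \<iota> m =
     (if 1 \<le> m then (seed_up (sqrt_q \<iota>) ^^ nat (m - 1)) (initial_seed \<iota>)
      else (seed_down (sqrt_q \<iota>) ^^ nat (1 - m)) (initial_seed \<iota>))"

text \<open>
  \<open>X\<^sub>m\<close> is the first cluster variable of \<open>\<Sigma>\<^sub>m\<close>. Mutation being an involution, the second and third
  ones are \<open>X\<^sub>m\<^sub>+\<^sub>1\<close> and \<open>X\<^sub>m\<^sub>+\<^sub>2\<close>.
\<close>

definition Xvar :: "(qtorus \<Rightarrow> 'f::division_ring) \<Rightarrow> int \<Rightarrow> 'f" where
  "Xvar \<iota> m = clus (Sigma_seed \<iota> m) 1"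

section \<open>The elements \<open>w\<close>, \<open>z\<close>, \<open>u\<^sub>n\<close>\<close>

definition w_elt :: qtorus where
  "w_elt = qX (vector [1, -1, 0, 0, 1, 0]) + qX (vector [0, -1, 1, 0, 0, 0])"

definition z_elt :: qtorus where
  "z_elt = qX (vector [0, 1, -1, 1, 0, 1]) + qX (vector [-1, 0, -1, 1, 0, 0])
         + qX (vector [-1, 1, 0, 0, 0, 0])"

definition u1_elt :: qtorus where
  "u1_elt = w_elt * z_elt - qhalf (-1) * qX (vector [0, 0, 0, 1, 0, 1])
          - qhalf 1 * qX (vector [0, 0, 0, 0, 1, 0])"

fun u_elt :: "nat \<Rightarrow> qtorus" where
  "u_elt 0 = 1"
| "u_elt (Suc 0) = u1_elt"
| "u_elt (Suc (Suc 0)) = u1_elt ^ 2 - 2 * qX (vector [0, 0, 0, 1, 1, 1])"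
| "u_elt (Suc (Suc (Suc n))) =
     u1_elt * u_elt (Suc (Suc n)) - qX (vector [0, 0, 0, 1, 1, 1]) * u_elt (Suc n)"

end

(*
  In every seed Sigma_m the cluster variables commute, and the rest of the seed has a closed form in m,
  so that X_m X_{m+3} = X_{m+1} X_{m+2} M + M' with explicit monomials M, M' in y1, y2, y3.
  The key identity is u_1 X_k = X_{k+2} S_k + X_{k-2} T_k with monomials S_k, T_k. For k = 2 it is a
  computation in the quantum torus. As X_k commutes with X_{k+2} and X_{k-2}, it also determines X_k u_1;
  multiplying that by X_{k+1} or X_{k-1} and using the exchange relations yields the identity for the
  neighbours of k after cancelling X_k. The identities for u_n follow by induction on n from the
  Chebyshev recursion.
*)

theory Submission
  imports Defs
begin


section \<open>Monomials of the quantum torus\<close>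

text \<open>Of the X_m only X_0, ..., X_4 are ever written as Laurent polynomials; the others are
  known through their exchange relations and their commutation weights with frozen monomials. The
  identity for u_1 starts at k = 2 because this is the only k for which X_{k-2}, X_k, X_{k+2} all
  lie in the initial cluster or one exchange away from it. What breaks uniformity is the sign of the
  mutated frozen column: it is nonnegative on the way up, but on the way down nonnegative for three
  mutations and nonpositive afterwards. Hence the relations for X_m X_{m+3} with m = 0, -1, -2 carry
  their frozen monomial on the other term, and u_1 X_k is treated separately for each k from -2 to
  3. The six identities reflect the same break: the coefficients for u_n are products of those for
  u_1 along k, k + 2, ... and k, k - 2, ...; the factors of the first are 1 at positive indices,
  those of the second at indices <= 0.\<close>

lemma UNIV_6: "(UNIV :: 6 set) = {1, 2, 3, 4, 5, 6}"
  by (rule sym, rule card_subset_eq) simp_all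

lemma vector_6 [simp]:
  fixes a b c d e f :: int
  shows "(vector [a, b, c, d, e, f] :: int ^ 6) $ 1 = a"
    "(vector [a, b, c, d, e, f] :: int ^ 6) $ 2 = b"
    "(vector [a, b, c, d, e, f] :: int ^ 6) $ 3 = c"
    "(vector [a, b, c, d, e, f] :: int ^ 6) $ 4 = d"
    "(vector [a, b, c, d, e, f] :: int ^ 6) $ 5 = e"
    "(vector [a, b, c, d, e, f] :: int ^ 6) $ 6 = f"
  using vector6_nth[of a b c d e f] by (simp_all add: upt_rec)

lemma vec6_eq_iff: "x = y \<longleftrightarrow> x $ 1 = y $ 1 \<and> x $ 2 = y $ 2 \<and> x $ 3 = y $ 3 \<and> x $ 4 = y $ 4 \<and> x $ 5 = y $ 5
    \<and> x $ 6 = y $ 6" for x y :: "int ^ 6"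
proof -
  have "(\<forall>i. P i) \<longleftrightarrow> P 1 \<and> P 2 \<and> P 3 \<and> P 4 \<and> P 5 \<and> P 6" for P :: "6 \<Rightarrow> bool"
  proof -
    have "(\<forall>i. P i) \<longleftrightarrow> (\<forall>i \<in> {1, 2, 3, 4, 5, 6}. P i)"
      using UNIV_6 by (metis UNIV_I)
    then show ?thesis by simp
  qed
  then show ?thesis unfolding vec_eq_iff .
qed

text \<open>Fixed coordinates reduce products and equality of torus monomials to integer
  arithmetic.\<close>

definition Tor :: "int \<Rightarrow> int \<Rightarrow> int \<Rightarrow> int \<Rightarrow> int \<Rightarrow> int \<Rightarrow> int \<Rightarrow> qtorus" where
  "Tor k a b c d e f = Poly_Mapping.single (QMon k (vector [a, b, c, d, e, f])) 1"

lemma Lambda_vector: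
  "Lambda (vector [a, b, c, d, e, f]) (vector [a', b', c', d', e', f']) =
     a' * d - a * d' + b' * e - b * e' + c' * f - c * f' +
     (e * d' - d * e') + (f * d' - d * f') + (f * e' - e * f')"
proof -
  have *: "{1..6::nat} = {1, 2, 3, 4, 5, 6}" by auto
  show ?thesis unfolding Lambda_def * by (simp add: lam_def algebra_simps)
qed

lemma vector_add6:
  "(vector [a, b, c, d, e, f] + vector [a', b', c', d', e', f'] :: int ^ 6) =
   vector [a + a', b + b', c + c', d + d', e + e', f + f']"
  by (subst vec6_eq_iff) simp

lemma vector_zero6: "(0 :: int ^ 6) = vector [0, 0, 0, 0, 0, 0]"
  by (subst vec6_eq_iff) simp

lemma Tor_mult:
  "Tor k a b c d e f * Tor k' a' b' c' d' e' f' =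
   Tor (k + k' + (a' * d - a * d' + b' * e - b * e' + c' * f - c * f' +
     (e * d' - d * e') + (f * d' - d * f') + (f * e' - e * f')))
     (a + a') (b + b') (c + c') (d + d') (e + e') (f + f')"
  by (simp add: Tor_def mult_single Lambda_vector vector_add6)

lemma qX_Tor: "qX (vector [a, b, c, d, e, f]) = Tor 0 a b c d e f"
  by (simp add: qX_def Tor_def)

lemma qhalf_Tor: "qhalf k = Tor k 0 0 0 0 0 0"
  by (simp add: qhalf_def Tor_def vector_zero6)

lemma one_Tor: "1 = Tor 0 0 0 0 0 0 0"
  using qhalf_Tor qhalf_zero by simp

lemma basis_vec_Tor:
  "qX (basis_vec (Suc 0)) = Tor 0 1 0 0 0 0 0" "qX (basis_vec 2) = Tor 0 0 1 0 0 0 0"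
  "qX (basis_vec 3) = Tor 0 0 0 1 0 0 0" "qX (basis_vec 4) = Tor 0 0 0 0 1 0 0"
  "qX (basis_vec 5) = Tor 0 0 0 0 0 1 0" "qX (basis_vec 6) = Tor 0 0 0 0 0 0 1"
proof -
  have "(axis 1 1 :: int ^ 6) = vector [1, 0, 0, 0, 0, 0]" "(axis 2 1 :: int ^ 6) = vector [0, 1, 0, 0, 0, 0]"
    "(axis 3 1 :: int ^ 6) = vector [0, 0, 1, 0, 0, 0]" "(axis 4 1 :: int ^ 6) = vector [0, 0, 0, 1, 0, 0]"
    "(axis 5 1 :: int ^ 6) = vector [0, 0, 0, 0, 1, 0]" "(axis 6 1 :: int ^ 6) = vector [0, 0, 0, 0, 0, 1]"
    by (subst vec6_eq_iff, simp add: axis_def)+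
  then show
    "qX (basis_vec (Suc 0)) = Tor 0 1 0 0 0 0 0" "qX (basis_vec 2) = Tor 0 0 1 0 0 0 0"
    "qX (basis_vec 3) = Tor 0 0 0 1 0 0 0" "qX (basis_vec 4) = Tor 0 0 0 0 1 0 0"
    "qX (basis_vec 5) = Tor 0 0 0 0 0 1 0" "qX (basis_vec 6) = Tor 0 0 0 0 0 0 1"
    by (simp_all add: qX_def Tor_def basis_vec_def)
qed

lemma Tor_eq_iff: "Tor k a b c d e f = Tor k' a' b' c' d' e' f' \<longleftrightarrow>
   k = k' \<and> a = a' \<and> b = b' \<and> c = c' \<and> d = d' \<and> e = e' \<and> f = f'"
proof -
  have "Poly_Mapping.single x (1 :: int) = Poly_Mapping.single y 1 \<longleftrightarrow> x = y" for x y :: qmon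
    by (metis keys_single one_neq_zero singleton_inject)
  then show ?thesis unfolding Tor_def by (simp add: vec6_eq_iff)
qed

text \<open>The two monomials subtracted in \<open>u1_elt\<close> cancel two of the six products in
  w * z. Multiplied by X_2, two of the four survivors form X_4 and the other two form X_0 times a
  frozen monomial.\<close>

lemma u1_Tor_X2:
  "u1_elt * Tor 0 0 1 0 0 0 0 =
     Tor 0 (-1) 0 0 1 0 0 + Tor 0 (-1) 1 1 0 0 0 +
     (Tor 0 1 1 (-1) 0 0 1 + Tor 0 0 0 (-1) 0 0 0) * Tor 1 0 0 0 1 1 0"
  unfolding u1_elt_def w_elt_def z_elt_def qX_Tor qhalf_Tor
  by (simp add: Tor_mult algebra_simps)



section \<open>Frozen monomials and exchange relations in the skew-field\<close>

lemma inverse_intertwine: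
  fixes x :: "'a::division_ring"
  assumes "x * a = b * x" "x \<noteq> 0"
  shows "inverse x * b = a * inverse x"
proof -
  have "inverse x * b = inverse x * (b * x) * inverse x"
    using \<open>x \<noteq> 0\<close> by (simp add: mult.assoc)
  also have "\<dots> = a * inverse x"
    using \<open>x \<noteq> 0\<close> by (simp flip: assms(1) mult.assoc)
  finally show ?thesis .
qed

locale quantum_torus_embedding =
  fixes \<iota> :: "qtorus \<Rightarrow> 'f::division_ring"
  assumes emb: "skew_field_of_fractions \<iota>"
begin

lemma emb_inj: "\<iota> x = \<iota> y \<longleftrightarrow> x = y"
  and emb_one: "\<iota> 1 = 1"
  and emb_add: "\<iota> (x + y) = \<iota> x + \<iota> y"
  and emb_mult: "\<iota> (x * y) = \<iota> x * \<iota> y"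
  using emb by (auto simp: skew_field_of_fractions_def inj_eq)

lemma emb_zero: "\<iota> 0 = 0"
  using emb_add[of 0 0] by simp

lemma emb_uminus: "\<iota> (- x) = - \<iota> x"
  using emb_add[of "- x" x] by (simp add: emb_zero eq_neg_iff_add_eq_0)

lemma emb_diff: "\<iota> (x - y) = \<iota> x - \<iota> y"
  using emb_add[of x "- y"] by (simp add: emb_uminus)

text \<open>The normalised monomial rather than an ordered product of the \<open>yvar\<close>:
  inversion then just negates all four parameters.\<close>

definition mon :: "int \<Rightarrow> int \<Rightarrow> int \<Rightarrow> int \<Rightarrow> 'f" where
  "mon e a b c = \<iota> (Tor e 0 0 0 a b c)"

lemma mon_mult: "mon e a b c * mon e' a' b' c' =
    mon (e + e' + ((b * a' - a * b') + (c * a' - a * c') + (c * b' - b * c'))) (a + a') (b + b') (c + c')"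
  by (simp add: mon_def Tor_mult flip: emb_mult)

lemma mon_one: "mon 0 0 0 0 = 1"
  by (simp add: mon_def emb_one flip: one_Tor)

lemma mon_eq_iff: "mon e a b c = mon e' a' b' c' \<longleftrightarrow> e = e' \<and> a = a' \<and> b = b' \<and> c = c'"
  by (simp add: mon_def emb_inj Tor_eq_iff)

lemma mon_inverse_mult: "mon (- e) (- a) (- b) (- c) * mon e a b c = 1"
  by (simp add: mon_mult mon_one algebra_simps)

lemma mon_nonzero: "mon e a b c \<noteq> 0"
  using mon_inverse_mult[of e a b c] by auto

lemma inverse_mon: "inverse (mon e a b c) = mon (- e) (- a) (- b) (- c)"
  using mon_inverse_mult by (metis inverse_unique inverse_inverse_eq nonzero_imp_inverse_nonzero mon_nonzero)

lemma mon_powi: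
  "mon 1 0 0 0 powi n = mon n 0 0 0" "mon 0 1 0 0 powi n = mon 0 n 0 0"
  "mon 0 0 1 0 powi n = mon 0 0 n 0" "mon 0 0 0 1 powi n = mon 0 0 0 n"
proof -
  have *: "mon 1 0 0 0 ^ k = mon (int k) 0 0 0" "mon 0 1 0 0 ^ k = mon 0 (int k) 0 0"
    "mon 0 0 1 0 ^ k = mon 0 0 (int k) 0" "mon 0 0 0 1 ^ k = mon 0 0 0 (int k)" for k
    by (induction k) (simp_all add: mon_one mon_mult)
  show "mon 1 0 0 0 powi n = mon n 0 0 0" "mon 0 1 0 0 powi n = mon 0 n 0 0"
    "mon 0 0 1 0 powi n = mon 0 0 n 0" "mon 0 0 0 1 powi n = mon 0 0 0 n"
    by (cases n rule: int_cases2; simp add: * power_int_minus inverse_mon)+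
qed

lemma sqrt_q_mon: "sqrt_q \<iota> = mon 1 0 0 0"
  by (simp add: sqrt_q_def qhalf_Tor mon_def)

lemma yvar_mon: "yvar \<iota> (Suc 0) = mon 0 1 0 0" "yvar \<iota> 2 = mon 0 0 1 0" "yvar \<iota> 3 = mon 0 0 0 1"
  by (simp_all add: yvar_def basis_vec_Tor mon_def)

text \<open>For \<open>x = X\<^sup>f\<close> this says that \<open>\<Lambda>(f, (0, 0, 0, d)) = (a, b, c) \<bullet> d\<close>, but it makes sense for every \<open>x\<close>.\<close>

definition qhom :: "'f \<Rightarrow> int \<Rightarrow> int \<Rightarrow> int \<Rightarrow> bool" where
  "qhom x a b c \<longleftrightarrow> (\<forall>e d1 d2 d3. x * mon e d1 d2 d3 = mon (e + 2 * (a * d1 + b * d2 + c * d3)) d1 d2 d3 * x)"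

lemma qhomD: "qhom x a b c \<Longrightarrow> x * mon e d1 d2 d3 = mon (e + 2 * (a * d1 + b * d2 + c * d3)) d1 d2 d3 * x"
  by (simp add: qhom_def)

lemma qhomD': "qhom x a b c \<Longrightarrow> mon e d1 d2 d3 * x = x * mon (e - 2 * (a * d1 + b * d2 + c * d3)) d1 d2 d3"
  by (simp add: qhom_def)

lemma qhom_mult:
  assumes "qhom x a b c" "qhom y a' b' c'"
  shows "qhom (x * y) (a + a') (b + b') (c + c')"
  unfolding qhom_def
proof (intro allI)
  fix e d1 d2 d3
  have "x * y * mon e d1 d2 d3 = x * (y * mon e d1 d2 d3)"
    by (simp add: mult.assoc)
  also have "\<dots> = (x * mon (e + 2 * (a' * d1 + b' * d2 + c' * d3)) d1 d2 d3) * y"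
    by (simp only: qhomD[OF assms(2)] mult.assoc)
  also have "\<dots> = mon (e + 2 * ((a + a') * d1 + (b + b') * d2 + (c + c') * d3)) d1 d2 d3 * (x * y)"
    by (simp only: qhomD[OF assms(1)] mult.assoc) (simp add: algebra_simps)
  finally show "x * y * mon e d1 d2 d3 =
      mon (e + 2 * ((a + a') * d1 + (b + b') * d2 + (c + c') * d3)) d1 d2 d3 * (x * y)" .
qed

lemma qhom_add: "qhom x a b c \<Longrightarrow> qhom y a b c \<Longrightarrow> qhom (x + y) a b c"
  by (simp add: qhom_def distrib_left distrib_right)

lemma qhom_inverse:
  assumes "qhom x a b c" "x \<noteq> 0"
  shows "qhom (inverse x) (- a) (- b) (- c)"
  unfolding qhom_def
proof (intro allI)
  fix e d1 d2 d3
  let ?M = "mon (e + 2 * (- a * d1 + - b * d2 + - c * d3)) d1 d2 d3"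
  have "x * ?M = mon e d1 d2 d3 * x"
    by (simp add: qhomD[OF assms(1)] algebra_simps)
  then show "inverse x * mon e d1 d2 d3 = ?M * inverse x"
    using \<open>x \<noteq> 0\<close> by (intro inverse_intertwine)
qed

lemma qhom_mon: "qhom (mon e a b c) (b + c) (c - a) (- a - b)"
  by (simp add: qhom_def mon_mult mon_eq_iff algebra_simps)

lemma commute_inverse: "x * y = y * x \<Longrightarrow> inverse x * y = y * inverse x" for x y :: 'f
  by (cases "x = 0") (simp_all add: inverse_intertwine)

text \<open>Since \<open>x * a\<close> and \<open>a * x\<close> differ in the sign of \<open>e\<close> only, \<open>x = 0\<close> would identify two distinct
  monomials.\<close>

lemma exchange:
  assumes "a \<noteq> 0" and comm: "a * b = b * a" "a * c = c * a" "b * c = c * b"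
    and hom: "qhom a a1 a2 a3" "qhom b b1 b2 b3" "qhom c c1 c2 c3"
    and e: "a1 * p1 + a2 * p2 + a3 * p3 = e" "e \<noteq> 0"
    and bp: "b1 * p1 + b2 * p2 + b3 * p3 = 0" and cp: "c1 * p1 + c2 * p2 + c3 * p3 = 0"
    and p: "p2 + p3 = b1 + c1" "p3 - p1 = b2 + c2" "- p1 - p2 = b3 + c3"
    and x: "x = inverse a * (b * c + mon e p1 p2 p3)"
  shows "a * x = b * c + mon e p1 p2 p3" "x * a = b * c + mon (- e) p1 p2 p3"
    "b * x = x * b" "c * x = x * c" "x \<noteq> 0" "qhom x (b1 + c1 - a1) (b2 + c2 - a2) (b3 + c3 - a3)"
proof -
  show ax: "a * x = b * c + mon e p1 p2 p3"
    using \<open>a \<noteq> 0\<close> by (simp add: x flip: mult.assoc)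
  have "a * (b * c) = b * c * a"
    using comm by (metis mult.assoc)
  then have "(b * c + mon e p1 p2 p3) * a = a * (b * c + mon (- e) p1 p2 p3)"
    using e by (simp add: distrib_left distrib_right qhomD[OF hom(1)])
  then show xa: "x * a = b * c + mon (- e) p1 p2 p3"
    using \<open>a \<noteq> 0\<close> by (simp add: x mult.assoc) (simp flip: mult.assoc)
  have "b * mon e p1 p2 p3 = mon e p1 p2 p3 * b" "c * mon e p1 p2 p3 = mon e p1 p2 p3 * c"
    using bp cp by (simp_all add: qhomD[OF hom(2)] qhomD[OF hom(3)])
  then have "b * (b * c + mon e p1 p2 p3) = (b * c + mon e p1 p2 p3) * b"
    "c * (b * c + mon e p1 p2 p3) = (b * c + mon e p1 p2 p3) * c"
    using comm by (simp_all add: distrib_left distrib_right mult.assoc) (simp flip: mult.assoc)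
  moreover have "b * inverse a = inverse a * b" "c * inverse a = inverse a * c"
    using comm by (simp_all add: commute_inverse)
  ultimately show "b * x = x * b" "c * x = x * c"
    by (metis x mult.assoc)+
  show "x \<noteq> 0"
  proof
    assume "x = 0"
    then have "mon e p1 p2 p3 = mon (- e) p1 p2 p3"
      using ax xa by (metis add_left_cancel mult_zero_left mult_zero_right)
    then show False
      using \<open>e \<noteq> 0\<close> by (simp add: mon_eq_iff)
  qed
  \<comment> \<open>By \<open>p\<close> both terms of the numerator have the same weights, so
    \<open>x\<close> is homogeneous.\<close>
  have "qhom (b * c) (b1 + c1) (b2 + c2) (b3 + c3)" "qhom (mon e p1 p2 p3) (b1 + c1) (b2 + c2) (b3 + c3)"
    using qhom_mult[OF hom(2,3)] qhom_mon[of e p1 p2 p3] p by simp_all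
  then show "qhom x (b1 + c1 - a1) (b2 + c2 - a2) (b3 + c3 - a3)"
    using qhom_mult[OF qhom_inverse[OF hom(1) \<open>a \<noteq> 0\<close>] qhom_add] x by simp
qed

end



section \<open>Mutation of the seeds\<close>

lemma atLeastAtMost_1_6: "{1..6::nat} = {1, 2, 3, 4, 5, 6}" "{Suc 0..6::nat} = {1, 2, 3, 4, 5, 6}"
  by auto

text \<open>E differs from the identity only in column k, so only row and column k of the form
  change, and only the corner keeps a double sum.\<close>

lemma mut_form_eq:
  fixes L B :: "nat \<Rightarrow> nat \<Rightarrow> int"
  assumes "k \<in> {1..6}" "i \<in> {1..6}" "j \<in> {1..6}"
  defines "e \<equiv> \<lambda>r. if r = k then -1 else ppart (- B r k)"
  shows "mut_form L B k i j =
     (if i = k then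
        (if j = k then (\<Sum>r=1..6. \<Sum>s=1..6. e r * L r s * e s) else (\<Sum>r=1..6. e r * L r j))
      else (if j = k then (\<Sum>s=1..6. L i s * e s) else L i j))"
proof -
  have E: "mut_E B k r i = (if i = k then e r else if r = i then 1 else 0)" for r i
    by (simp add: mut_E_def e_def)
  have row: "(\<Sum>r=1..6. (if r = i then 1 else 0) * f r) = f i" if "i \<in> {1..6}" for i :: nat and f :: "nat \<Rightarrow> int"
    using that by (simp add: if_distrib[of "\<lambda>x. x * _"] cong: if_cong)
  have col: "(\<Sum>s=1..6. f s * (if s = i then 1 else 0)) = f i" if "i \<in> {1..6}" for i :: nat and f :: "nat \<Rightarrow> int"
    using row[OF that, of f] by (simp add: mult.commute)
  have inner: "(\<Sum>s=1..6. mut_E B k r i * L r s * mut_E B k s j) =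
      mut_E B k r i * (if j = k then (\<Sum>s=1..6. L r s * e s) else L r j)" for r
    using col[OF assms(3), of "L r"] by (simp add: E mult.assoc flip: sum_distrib_left)
  show ?thesis
    unfolding mut_form_def inner
    using row[OF assms(2)] by (simp add: E sum_distrib_left mult.assoc)
qed

context quantum_torus_embedding
begin

text \<open>All seeds \<open>\<Sigma>\<^sub>m\<close> have the upper part of the exchange matrix, the vanishing of the form on the cluster
  and its values on the frozen variables in common. They differ in \<open>G i j = \<Lambda>(X\<^sub>i, y\<^sub>j)\<close> and in the lower
  part \<open>C\<close> of the exchange matrix.\<close>

definition seed_shape :: "'f qseed \<Rightarrow> (nat \<Rightarrow> nat \<Rightarrow> int) \<Rightarrow> (nat \<Rightarrow> nat \<Rightarrow> int) \<Rightarrow> bool" where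
  "seed_shape s G C \<longleftrightarrow>
     (\<forall>i\<in>{1, 2, 3}. \<forall>j\<in>{1, 2, 3}. form s i j = 0 \<and> form s i (j + 3) = G i j \<and>
        form s (i + 3) j = - G j i \<and> form s (i + 3) (j + 3) = lam (i + 3) (j + 3) \<and>
        exch s i j = Btilde i j \<and> exch s (i + 3) j = C i j) \<and>
     (\<forall>i\<in>{1, 2, 3}. clus s (i + 3) = yvar \<iota> i)"

text \<open>\<open>toric\<close> reads only the form and the cluster. Without conditions on the
  exchange matrix this also covers the seed from which z arises: it is Sigma_2 before reordering,
  and the upper part of its exchange matrix is not that of \<open>Btilde\<close>.\<close>

definition form_shape :: "'f qseed \<Rightarrow> (nat \<Rightarrow> nat \<Rightarrow> int) \<Rightarrow> bool" where
  "form_shape s G \<longleftrightarrow>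
     (\<forall>i\<in>{1, 2, 3}. \<forall>j\<in>{1, 2, 3}. form s i j = 0 \<and> form s i (j + 3) = G i j \<and>
        form s (i + 3) j = - G j i \<and> form s (i + 3) (j + 3) = lam (i + 3) (j + 3)) \<and>
     (\<forall>i\<in>{1, 2, 3}. clus s (i + 3) = yvar \<iota> i)"

lemma seed_shape_form: "seed_shape s G C \<Longrightarrow> form_shape s G"
  by (auto simp: seed_shape_def form_shape_def)

definition cluster_shape :: "'f qseed \<Rightarrow> (nat \<Rightarrow> nat \<Rightarrow> int) \<Rightarrow> bool" where
  "cluster_shape s G \<longleftrightarrow>
     (\<forall>i\<in>{1, 2, 3}. clus s i \<noteq> 0 \<and> qhom (clus s i) (G i 1) (G i 2) (G i 3) \<and>
        (\<forall>j\<in>{1, 2, 3}. clus s i * clus s j = clus s j * clus s i))"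

text \<open>The normalising exponent has three parts. Pairs of cluster indices contribute 0, pairs
  of frozen indices are absorbed when the ordered product of the y_j is rewritten as one
  \<open>mon\<close>, and the mixed pairs remain.\<close>

lemma toric_seed:
  assumes "form_shape s G" and c: "qhom (clus s 1) a1 a2 a3" "qhom (clus s 2) b1 b2 b3" "qhom (clus s 3) c1 c2 c3"
    and nz: "clus s 1 \<noteq> 0" "clus s 2 \<noteq> 0" "clus s 3 \<noteq> 0"
  shows "toric (sqrt_q \<iota>) (form s) (clus s) c =
    clus s 1 powi c 1 * clus s 2 powi c 2 * clus s 3 powi c 3 *
    mon (- (\<Sum>i\<in>{1, 2, 3}. \<Sum>j\<in>{1, 2, 3}. c i * c (j + 3) * G i j)) (c 4) (c 5) (c 6)"
proof -
  \<comment> \<open>Powers of q pair to 0 with all weights, so they move past every homogeneous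
    \<open>x\<close>; the trailing \<open>z\<close> allows chaining.\<close>
  have v: "mon e 0 0 0 * (x powi n * z) = x powi n * (mon e 0 0 0 * z)"
    if "qhom x a b d" "x \<noteq> 0" for x n a b d e z
  proof -
    have *: "x ^ k * mon e 0 0 0 = mon e 0 0 0 * x ^ k" if "x * mon e 0 0 0 = mon e 0 0 0 * x" for k x
      using that by (metis power_commuting_commutes)
    have "x powi n * mon e 0 0 0 = mon e 0 0 0 * x powi n"
      using that qhomD[OF that(1), of e 0 0 0] qhomD[OF qhom_inverse[OF that], of e 0 0 0]
      by (cases n rule: int_cases2) (simp_all add: power_int_minus * flip: power_inverse)
    then show ?thesis
      by (simp flip: mult.assoc)
  qed
  let ?Y = "mon (- c 4 * c 5 - c 4 * c 6 - c 5 * c 6) (c 4) (c 5) (c 6)"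
  let ?e = "- ((\<Sum>i\<in>{1, 2, 3}. \<Sum>j\<in>{1, 2, 3}. c i * c (j + 3) * G i j) - c 4 * c 5 - c 4 * c 6 - c 5 * c 6)"
  have "toric (sqrt_q \<iota>) (form s) (clus s) c =
     mon (- (\<Sum>j=1..6. \<Sum>i=1..<j. c i * c j * form s i j)) 0 0 0 *
     (clus s 1 powi c 1 * (clus s 2 powi c 2 * (clus s 3 powi c 3 * mon (- c 4 * c 5 - c 4 * c 6 - c 5 * c 6) (c 4) (c 5) (c 6))))"
  proof -
    have 1: "[1..<7] = [1, 2, 3, 4, 5, 6::nat]"
      by (simp add: upt_rec eval_nat_numeral)
    have 2: "clus s 4 = mon 0 1 0 0" "clus s 5 = mon 0 0 1 0" "clus s 6 = mon 0 0 0 1"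
      using assms(1) by (simp_all add: form_shape_def yvar_mon)
    show ?thesis
      unfolding toric_def sqrt_q_mon mon_powi 1 by (simp add: 2 mon_powi mon_mult mult.assoc)
  qed
  also have "(\<Sum>j=1..6. \<Sum>i=1..<j. c i * c j * form s i j) =
     (\<Sum>i\<in>{1, 2, 3}. \<Sum>j\<in>{1, 2, 3}. c i * c (j + 3) * G i j) - c 4 * c 5 - c 4 * c 6 - c 5 * c 6"
  proof -
    have "{1..<2} = {1::nat}" "{1..<3} = {1, 2::nat}" "{1..<4} = {1, 2, 3::nat}"
      "{1..<5} = {1, 2, 3, 4::nat}" "{1..<6} = {1, 2, 3, 4, 5::nat}" by auto
    then show ?thesis
      using assms(1) unfolding atLeastAtMost_1_6 form_shape_def
      by (simp add: lam_def algebra_simps)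
  qed
  finally have "toric (sqrt_q \<iota>) (form s) (clus s) c = mon ?e 0 0 0 *
     (clus s 1 powi c 1 * (clus s 2 powi c 2 * (clus s 3 powi c 3 * ?Y)))" .
  also have "\<dots> = clus s 1 powi c 1 * clus s 2 powi c 2 * clus s 3 powi c 3 * (mon ?e 0 0 0 * ?Y)"
    by (simp only: v[OF c(1) nz(1)] v[OF c(2) nz(2)] v[OF c(3) nz(3)] mult.assoc)
  finally show ?thesis
    by (simp add: mon_mult algebra_simps)
qed


section \<open>Form and exchange matrix after one step along the chain\<close>

text \<open>Column 1 is (0, -1, -1, p) with p >= 0, so the positive part of its negative involves
  X_2 and X_3 only: the new weights are G 2 + G 3 - G 1, and the form stays 0 on the
  cluster.\<close>

lemma seed_shape_up:
  assumes s: "seed_shape s G C" and nn: "0 \<le> C 1 1" "0 \<le> C 2 1" "0 \<le> C 3 1"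
    and G': "\<And>j. j \<in> {1, 2, 3} \<Longrightarrow> G' 1 j = G 2 j" "\<And>j. j \<in> {1, 2, 3} \<Longrightarrow> G' 2 j = G 3 j"
      "\<And>j. j \<in> {1, 2, 3} \<Longrightarrow> G' 3 j = G 2 j + G 3 j - G 1 j"
    and C': "\<And>j. j \<in> {1, 2, 3} \<Longrightarrow> C' j 1 = C j 2 + C j 1" "\<And>j. j \<in> {1, 2, 3} \<Longrightarrow> C' j 2 = C j 3 + C j 1"
      "\<And>j. j \<in> {1, 2, 3} \<Longrightarrow> C' j 3 = - C j 1"
  shows "seed_shape (seed_up v s) G' C'"
proof -
  have p: "ppart (- 1) = 0" "ppart 1 = 1" "ppart 0 = 0" "ppart (- C 1 1) = 0" "ppart (- C 2 1) = 0" "ppart (- C 3 1) = 0"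
    using nn by (simp_all add: ppart_def)
  show ?thesis
    using s nn G' C' p unfolding seed_shape_def seed_up_def mutate_def reorder_def
    by (simp add: mut_form_eq mut_exch_def mut_clus_def Btilde_def atLeastAtMost_1_6 split del: if_split)
qed

text \<open>Column 3 has no negative entry, so E merely changes the sign of the third basis
  vector.\<close>

lemma seed_shape_down_nonneg:
  assumes s: "seed_shape s G C" and nn: "0 \<le> C 1 3" "0 \<le> C 2 3" "0 \<le> C 3 3"
    and G': "\<And>j. j \<in> {1, 2, 3} \<Longrightarrow> G' 1 j = - G 3 j" "\<And>j. j \<in> {1, 2, 3} \<Longrightarrow> G' 2 j = G 1 j"
      "\<And>j. j \<in> {1, 2, 3} \<Longrightarrow> G' 3 j = G 2 j"
    and C': "\<And>j. j \<in> {1, 2, 3} \<Longrightarrow> C' j 1 = - C j 3" "\<And>j. j \<in> {1, 2, 3} \<Longrightarrow> C' j 2 = C j 1"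
      "\<And>j. j \<in> {1, 2, 3} \<Longrightarrow> C' j 3 = C j 2"
  shows "seed_shape (seed_down v s) G' C'"
proof -
  have p: "ppart (- 1) = 0" "ppart 1 = 1" "ppart 0 = 0" "ppart (- C 1 3) = 0" "ppart (- C 2 3) = 0" "ppart (- C 3 3) = 0"
    using nn by (simp_all add: ppart_def)
  show ?thesis
    using s nn G' C' p unfolding seed_shape_def seed_down_def mutate_def reorder_def
    by (simp add: mut_form_eq mut_exch_def mut_clus_def Btilde_def atLeastAtMost_1_6 split del: if_split)
qed

text \<open>Here the positive part of the negated column 3 is purely frozen. The new weights come
  out as a pairing of frozen vectors minus G 3; \<open>comp\<close> turns this into G 1 + G 2 - G 3,
  and \<open>orth\<close> keeps the form 0 on the new cluster.\<close>

lemma seed_shape_down_nonpos: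
  assumes s: "seed_shape s G C" and np: "C 1 3 = - n1" "C 2 3 = - n2" "C 3 3 = - n3" "0 \<le> n1" "0 \<le> n2" "0 \<le> n3"
    and G': "\<And>j. j \<in> {1, 2, 3} \<Longrightarrow> G' 1 j = G 1 j + G 2 j - G 3 j" "\<And>j. j \<in> {1, 2, 3} \<Longrightarrow> G' 2 j = G 1 j"
      "\<And>j. j \<in> {1, 2, 3} \<Longrightarrow> G' 3 j = G 2 j"
    and C': "\<And>j. j \<in> {1, 2, 3} \<Longrightarrow> C' j 1 = - C j 3" "\<And>j. j \<in> {1, 2, 3} \<Longrightarrow> C' j 2 = C j 1 + C j 3"
      "\<And>j. j \<in> {1, 2, 3} \<Longrightarrow> C' j 3 = C j 2 + C j 3"
    and orth: "G 1 1 * n1 + G 1 2 * n2 + G 1 3 * n3 = 0" "G 2 1 * n1 + G 2 2 * n2 + G 2 3 * n3 = 0"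
    and comp: "n2 + n3 = G 1 1 + G 2 1" "n3 - n1 = G 1 2 + G 2 2" "- n1 - n2 = G 1 3 + G 2 3"
  shows "seed_shape (seed_down v s) G' C'"
proof -
  have p: "ppart (- 1) = 0" "ppart 1 = 1" "ppart 0 = 0" "ppart n1 = n1" "ppart n2 = n2" "ppart n3 = n3"
    using np by (simp_all add: ppart_def)
  have orth': "- (n2 * G 1 2) - n3 * G 1 3 = n1 * G 1 1" "- (n2 * G 2 2) - n3 * G 2 3 = n1 * G 2 1"
      "G 1 1 * n1 + (G 1 2 * n2 + G 1 3 * n3) = 0" "G 2 1 * n1 + (G 2 2 * n2 + G 2 3 * n3) = 0"
    using orth by (simp_all add: algebra_simps)
  have half: "- (2 * n) div 2 = - n" for n :: int
    by simp
  show ?thesis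
    using s np G' C' p comp unfolding seed_shape_def seed_down_def mutate_def reorder_def
    by (simp add: mut_form_eq mut_exch_def mut_clus_def Btilde_def lam_def atLeastAtMost_1_6 split del: if_split)
      (use orth' in \<open>simp add: half\<close>)
qed


section \<open>Cluster and exchange relations after one step along the chain\<close>

lemma commute_mult: "z * y = y * z \<Longrightarrow> z * m = m * z \<Longrightarrow> z * (y * m) = y * m * z" for z :: 'f
  by (metis mult.assoc)

lemma ball_123: "(\<forall>i\<in>{1, 2, 3::nat}. P i) \<longleftrightarrow> P 1 \<and> P 2 \<and> P 3"
  by auto

lemma cluster_shape_alt: "cluster_shape s G \<longleftrightarrow>
    clus s 1 \<noteq> 0 \<and> clus s 2 \<noteq> 0 \<and> clus s 3 \<noteq> 0 \<and>
    qhom (clus s 1) (G 1 1) (G 1 2) (G 1 3) \<and> qhom (clus s 2) (G 2 1) (G 2 2) (G 2 3) \<and>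
    qhom (clus s 3) (G 3 1) (G 3 2) (G 3 3) \<and>
    clus s 1 * clus s 2 = clus s 2 * clus s 1 \<and> clus s 1 * clus s 3 = clus s 3 * clus s 1 \<and>
    clus s 2 * clus s 3 = clus s 3 * clus s 2"
  unfolding cluster_shape_def ball_123 by metis

lemma step_up:
  assumes s: "seed_shape s G C" "cluster_shape s G"
    and nn: "C 1 1 = p1" "C 2 1 = p2" "C 3 1 = p3" "0 \<le> p1" "0 \<le> p2" "0 \<le> p3"
    and G': "\<And>j. j \<in> {1, 2, 3} \<Longrightarrow> G' 1 j = G 2 j" "\<And>j. j \<in> {1, 2, 3} \<Longrightarrow> G' 2 j = G 3 j"
      "\<And>j. j \<in> {1, 2, 3} \<Longrightarrow> G' 3 j = G 2 j + G 3 j - G 1 j"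
    and orth: "G 1 1 * p1 + G 1 2 * p2 + G 1 3 * p3 = -1" "G 2 1 * p1 + G 2 2 * p2 + G 2 3 * p3 = 0"
      "G 3 1 * p1 + G 3 2 * p2 + G 3 3 * p3 = 0"
    and comp: "p2 + p3 = G 2 1 + G 3 1" "p3 - p1 = G 2 2 + G 3 2" "- p1 - p2 = G 2 3 + G 3 3"
  shows "clus (seed_up (sqrt_q \<iota>) s) 1 = clus s 2" "clus (seed_up (sqrt_q \<iota>) s) 2 = clus s 3"
    "clus s 1 * clus (seed_up (sqrt_q \<iota>) s) 3 = clus s 2 * clus s 3 + mon (-1) p1 p2 p3"
    "clus (seed_up (sqrt_q \<iota>) s) 3 * clus s 1 = clus s 2 * clus s 3 + mon 1 p1 p2 p3"
    "cluster_shape (seed_up (sqrt_q \<iota>) s) G'"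
proof -
  let ?s' = "seed_up (sqrt_q \<iota>) s"
  note cl = s(2)[unfolded cluster_shape_alt]
  show c12: "clus ?s' 1 = clus s 2" "clus ?s' 2 = clus s 3"
    by (simp_all add: seed_up_def reorder_def mutate_def mut_clus_def)
  have p: "ppart (- 1) = 0" "ppart 1 = 1" "ppart 0 = 0" "ppart (- p1) = 0" "ppart (- p2) = 0" "ppart (- p3) = 0"
    "ppart p1 = p1" "ppart p2 = p2" "ppart p3 = p3"
    using nn by (simp_all add: ppart_def)
  have ex: "exch s 1 1 = 0" "exch s 2 1 = -1" "exch s 3 1 = -1" "exch s 4 1 = p1" "exch s 5 1 = p2" "exch s 6 1 = p3"
    using s(1) nn unfolding seed_shape_def by (simp_all add: Btilde_def)
  have "clus ?s' 3 = toric (sqrt_q \<iota>) (form s) (clus s) (\<lambda>i. (if i = 1 then -1 else 0) + ppart (exch s i 1)) +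
        toric (sqrt_q \<iota>) (form s) (clus s) (\<lambda>i. (if i = 1 then -1 else 0) + ppart (- exch s i 1))"
    by (simp add: seed_up_def reorder_def mutate_def mut_clus_def)
  \<comment> \<open>The exponent -1 is the mixed part of the normalisation, evaluated by the first
    equation of \<open>orth\<close>.\<close>
  also have "\<dots> = inverse (clus s 1) * mon (-1) p1 p2 p3 + inverse (clus s 1) * (clus s 2 * clus s 3)"
    using cl ex p orth(1)
    by (subst (1 2) toric_seed[OF seed_shape_form[OF s(1)], of "G 1 1" "G 1 2" "G 1 3" "G 2 1" "G 2 2" "G 2 3" "G 3 1" "G 3 2" "G 3 3"])
      (simp_all add: power_int_minus mon_one mult.assoc algebra_simps)
  finally have x: "clus ?s' 3 = inverse (clus s 1) * (clus s 2 * clus s 3 + mon (-1) p1 p2 p3)"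
    by (simp add: distrib_left)
  have hom: "qhom (clus s 1) (G 1 1) (G 1 2) (G 1 3)" "qhom (clus s 2) (G 2 1) (G 2 2) (G 2 3)"
    "qhom (clus s 3) (G 3 1) (G 3 2) (G 3 3)" using cl by simp_all
  have comm: "clus s 1 * clus s 2 = clus s 2 * clus s 1" "clus s 1 * clus s 3 = clus s 3 * clus s 1"
    "clus s 2 * clus s 3 = clus s 3 * clus s 2" and nz: "clus s 1 \<noteq> 0" using cl by simp_all
  note E = exchange[OF nz comm hom orth(1) _ orth(2,3) comp x]
  show "clus s 1 * clus ?s' 3 = clus s 2 * clus s 3 + mon (-1) p1 p2 p3"
    "clus ?s' 3 * clus s 1 = clus s 2 * clus s 3 + mon 1 p1 p2 p3"
    using E(1,2) by simp_all
  show "cluster_shape ?s' G'"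
    unfolding cluster_shape_alt c12 using cl E(3-6) G' by simp
qed

text \<open>The same compatibility in column 3. As n is the negated column, the nonzero pairing is 1
  instead of -1, which swaps the two exponents compared with \<open>step_up\<close>.\<close>

lemma step_down_nonpos:
  assumes s: "seed_shape s G C" "cluster_shape s G"
    and np: "C 1 3 = - n1" "C 2 3 = - n2" "C 3 3 = - n3" "0 \<le> n1" "0 \<le> n2" "0 \<le> n3"
    and G': "\<And>j. j \<in> {1, 2, 3} \<Longrightarrow> G' 1 j = G 1 j + G 2 j - G 3 j" "\<And>j. j \<in> {1, 2, 3} \<Longrightarrow> G' 2 j = G 1 j"
      "\<And>j. j \<in> {1, 2, 3} \<Longrightarrow> G' 3 j = G 2 j"
    and orth: "G 3 1 * n1 + G 3 2 * n2 + G 3 3 * n3 = 1" "G 1 1 * n1 + G 1 2 * n2 + G 1 3 * n3 = 0"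
      "G 2 1 * n1 + G 2 2 * n2 + G 2 3 * n3 = 0"
    and comp: "n2 + n3 = G 1 1 + G 2 1" "n3 - n1 = G 1 2 + G 2 2" "- n1 - n2 = G 1 3 + G 2 3"
  shows "clus (seed_down (sqrt_q \<iota>) s) 2 = clus s 1" "clus (seed_down (sqrt_q \<iota>) s) 3 = clus s 2"
    "clus s 3 * clus (seed_down (sqrt_q \<iota>) s) 1 = clus s 1 * clus s 2 + mon 1 n1 n2 n3"
    "clus (seed_down (sqrt_q \<iota>) s) 1 * clus s 3 = clus s 1 * clus s 2 + mon (-1) n1 n2 n3"
    "cluster_shape (seed_down (sqrt_q \<iota>) s) G'"
proof -
  let ?s' = "seed_down (sqrt_q \<iota>) s"
  note cl = s(2)[unfolded cluster_shape_alt]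
  show c12: "clus ?s' 2 = clus s 1" "clus ?s' 3 = clus s 2"
    by (simp_all add: seed_down_def reorder_def mutate_def mut_clus_def)
  have p: "ppart (- 1) = 0" "ppart 1 = 1" "ppart 0 = 0" "ppart (- n1) = 0" "ppart (- n2) = 0" "ppart (- n3) = 0"
    "ppart n1 = n1" "ppart n2 = n2" "ppart n3 = n3"
    using np by (simp_all add: ppart_def)
  have ex: "exch s 3 3 = 0" "exch s 1 3 = 1" "exch s 2 3 = 1" "exch s 4 3 = - n1" "exch s 5 3 = - n2" "exch s 6 3 = - n3"
    using s(1) np unfolding seed_shape_def by (simp_all add: Btilde_def)
  have hom: "qhom (clus s 3) (G 3 1) (G 3 2) (G 3 3)" "qhom (clus s 1) (G 1 1) (G 1 2) (G 1 3)"
    "qhom (clus s 2) (G 2 1) (G 2 2) (G 2 3)" using cl by simp_all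
  have comm: "clus s 3 * clus s 1 = clus s 1 * clus s 3" "clus s 3 * clus s 2 = clus s 2 * clus s 3"
    "clus s 1 * clus s 2 = clus s 2 * clus s 1" and nz: "clus s 3 \<noteq> 0" "clus s 1 \<noteq> 0" "clus s 2 \<noteq> 0"
    using cl by simp_all
  have inv: "clus s 1 * (clus s 2 * inverse (clus s 3)) = inverse (clus s 3) * (clus s 1 * clus s 2)"
    using commute_inverse[OF comm(1)] commute_inverse[OF comm(2)] by (metis mult.assoc)
  have "clus ?s' 1 = toric (sqrt_q \<iota>) (form s) (clus s) (\<lambda>i. (if i = 3 then -1 else 0) + ppart (exch s i 3)) +
        toric (sqrt_q \<iota>) (form s) (clus s) (\<lambda>i. (if i = 3 then -1 else 0) + ppart (- exch s i 3))"
    by (simp add: seed_down_def reorder_def mutate_def mut_clus_def)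
  also have "\<dots> = clus s 1 * (clus s 2 * inverse (clus s 3)) + inverse (clus s 3) * mon 1 n1 n2 n3"
    using hom nz ex p orth(1)
    by (subst (1 2) toric_seed[OF seed_shape_form[OF s(1)], of "G 1 1" "G 1 2" "G 1 3" "G 2 1" "G 2 2" "G 2 3" "G 3 1" "G 3 2" "G 3 3"])
      (simp_all add: power_int_minus mon_one mult.assoc algebra_simps)
  finally have x: "clus ?s' 1 = inverse (clus s 3) * (clus s 1 * clus s 2 + mon 1 n1 n2 n3)"
    using inv by (simp add: distrib_left)
  note E = exchange[OF nz(1) comm hom orth(1) _ orth(2,3) comp x]
  show "clus s 3 * clus ?s' 1 = clus s 1 * clus s 2 + mon 1 n1 n2 n3"
    "clus ?s' 1 * clus s 3 = clus s 1 * clus s 2 + mon (-1) n1 n2 n3"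
    using E(1,2) by simp_all
  show "cluster_shape ?s' G'"
    unfolding cluster_shape_alt c12 using cl E(3-6) G' by simp
qed

text \<open>For a nonnegative column the new variable is that of the nonpositive case, with the negated
  column, times a frozen monomial.\<close>

lemma step_down_nonneg:
  assumes s: "seed_shape s G C" "cluster_shape s G"
    and nn: "C 1 3 = p1" "C 2 3 = p2" "C 3 3 = p3" "0 \<le> p1" "0 \<le> p2" "0 \<le> p3"
    and G': "\<And>j. j \<in> {1, 2, 3} \<Longrightarrow> G' 1 j = - G 3 j" "\<And>j. j \<in> {1, 2, 3} \<Longrightarrow> G' 2 j = G 1 j"
      "\<And>j. j \<in> {1, 2, 3} \<Longrightarrow> G' 3 j = G 2 j"
    and orth: "G 3 1 * p1 + G 3 2 * p2 + G 3 3 * p3 = -1" "G 1 1 * p1 + G 1 2 * p2 + G 1 3 * p3 = 0"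
      "G 2 1 * p1 + G 2 2 * p2 + G 2 3 * p3 = 0"
    and comp: "- p2 - p3 = G 1 1 + G 2 1" "p1 - p3 = G 1 2 + G 2 2" "p1 + p2 = G 1 3 + G 2 3"
  shows "clus (seed_down (sqrt_q \<iota>) s) 2 = clus s 1" "clus (seed_down (sqrt_q \<iota>) s) 3 = clus s 2"
    "clus s 3 * clus (seed_down (sqrt_q \<iota>) s) 1 = clus s 1 * clus s 2 * mon (-1) p1 p2 p3 + 1"
    "clus (seed_down (sqrt_q \<iota>) s) 1 * clus s 3 = clus s 1 * clus s 2 * mon 1 p1 p2 p3 + 1"
    "cluster_shape (seed_down (sqrt_q \<iota>) s) G'"
proof -
  let ?s' = "seed_down (sqrt_q \<iota>) s"
  note cl = s(2)[unfolded cluster_shape_alt]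
  show c12: "clus ?s' 2 = clus s 1" "clus ?s' 3 = clus s 2"
    by (simp_all add: seed_down_def reorder_def mutate_def mut_clus_def)
  have p: "ppart (- 1) = 0" "ppart 1 = 1" "ppart 0 = 0" "ppart (- p1) = 0" "ppart (- p2) = 0" "ppart (- p3) = 0"
    "ppart p1 = p1" "ppart p2 = p2" "ppart p3 = p3"
    using nn by (simp_all add: ppart_def)
  have ex: "exch s 3 3 = 0" "exch s 1 3 = 1" "exch s 2 3 = 1" "exch s 4 3 = p1" "exch s 5 3 = p2" "exch s 6 3 = p3"
    using s(1) nn unfolding seed_shape_def by (simp_all add: Btilde_def)
  have hom: "qhom (clus s 3) (G 3 1) (G 3 2) (G 3 3)" "qhom (clus s 1) (G 1 1) (G 1 2) (G 1 3)"
    "qhom (clus s 2) (G 2 1) (G 2 2) (G 2 3)" using cl by simp_all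
  have comm: "clus s 3 * clus s 1 = clus s 1 * clus s 3" "clus s 3 * clus s 2 = clus s 2 * clus s 3"
    "clus s 1 * clus s 2 = clus s 2 * clus s 1" and nz: "clus s 3 \<noteq> 0" "clus s 1 \<noteq> 0" "clus s 2 \<noteq> 0"
    using cl by simp_all
  have inv: "clus s 1 * (clus s 2 * inverse (clus s 3)) = inverse (clus s 3) * (clus s 1 * clus s 2)"
    using commute_inverse[OF comm(1)] commute_inverse[OF comm(2)] by (metis mult.assoc)
  define y where "y = inverse (clus s 3) * (clus s 1 * clus s 2 + mon 1 (- p1) (- p2) (- p3))"
  have "clus ?s' 1 = toric (sqrt_q \<iota>) (form s) (clus s) (\<lambda>i. (if i = 3 then -1 else 0) + ppart (exch s i 3)) +
        toric (sqrt_q \<iota>) (form s) (clus s) (\<lambda>i. (if i = 3 then -1 else 0) + ppart (- exch s i 3))"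
    by (simp add: seed_down_def reorder_def mutate_def mut_clus_def)
  also have "\<dots> = clus s 1 * (clus s 2 * inverse (clus s 3)) *
        mon (G 3 1 * p1 + G 3 2 * p2 + G 3 3 * p3 - (G 1 1 * p1 + G 1 2 * p2 + G 1 3 * p3)
          - (G 2 1 * p1 + G 2 2 * p2 + G 2 3 * p3)) p1 p2 p3 + inverse (clus s 3)"
    using hom nz ex p
    by (subst (1 2) toric_seed[OF seed_shape_form[OF s(1)], of "G 1 1" "G 1 2" "G 1 3" "G 2 1" "G 2 2" "G 2 3" "G 3 1" "G 3 2" "G 3 3"])
      (simp_all add: power_int_minus mon_one mult.assoc algebra_simps)
  also have "\<dots> = inverse (clus s 3) * (clus s 1 * clus s 2) * mon (-1) p1 p2 p3 + inverse (clus s 3)"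
    unfolding inv orth by simp
  also have "\<dots> = y * mon (-1) p1 p2 p3"
    by (simp add: y_def distrib_left distrib_right mult.assoc mon_mult mon_one algebra_simps)
  finally have x: "clus ?s' 1 = y * mon (-1) p1 p2 p3" .
  have orth': "G 3 1 * (- p1) + G 3 2 * (- p2) + G 3 3 * (- p3) = 1" "G 1 1 * (- p1) + G 1 2 * (- p2) + G 1 3 * (- p3) = 0"
      "G 2 1 * (- p1) + G 2 2 * (- p2) + G 2 3 * (- p3) = 0" using orth by simp_all
  have comp': "- p2 + - p3 = G 1 1 + G 2 1" "- p3 - - p1 = G 1 2 + G 2 2" "- (- p1) - - p2 = G 1 3 + G 2 3"
    using comp by simp_all
  note E = exchange[OF nz(1) comm hom orth'(1) _ orth'(2,3) comp' y_def]
  show "clus s 3 * clus ?s' 1 = clus s 1 * clus s 2 * mon (-1) p1 p2 p3 + 1"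
    using E(1) unfolding x mult.assoc[symmetric] by (simp add: distrib_right mon_mult mon_one)
  have "clus ?s' 1 * clus s 3 = y * (mon (-1) p1 p2 p3 * clus s 3)"
    unfolding x mult.assoc ..
  also have "\<dots> = y * clus s 3 * mon 1 p1 p2 p3"
    unfolding qhomD'[OF hom(1)] orth by (simp add: mult.assoc)
  also have "\<dots> = clus s 1 * clus s 2 * mon 1 p1 p2 p3 + 1"
    using E(2) by (simp add: distrib_right mon_mult mon_one algebra_simps flip: mult.assoc)
  finally show "clus ?s' 1 * clus s 3 = clus s 1 * clus s 2 * mon 1 p1 p2 p3 + 1" .
  have m: "clus s 1 * mon (-1) p1 p2 p3 = mon (-1) p1 p2 p3 * clus s 1" "clus s 2 * mon (-1) p1 p2 p3 = mon (-1) p1 p2 p3 * clus s 2"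
    unfolding qhomD[OF hom(2)] qhomD[OF hom(3)] orth by simp_all
  have c: "clus s 1 * clus ?s' 1 = clus ?s' 1 * clus s 1" "clus s 2 * clus ?s' 1 = clus ?s' 1 * clus s 2"
    unfolding x using commute_mult[OF E(3) m(1)] commute_mult[OF E(4) m(2)] by simp_all
  have "qhom (clus ?s' 1) (- G 3 1) (- G 3 2) (- G 3 3)"
  proof -
    have "G 1 1 + G 2 1 - G 3 1 + (p2 + p3) = - G 3 1" "G 1 2 + G 2 2 - G 3 2 + (p3 - p1) = - G 3 2"
      "G 1 3 + G 2 3 - G 3 3 + (- p1 - p2) = - G 3 3"
      using comp by simp_all
    note eq = this
    show ?thesis
      using qhom_mult[OF E(6) qhom_mon[of "-1" p1 p2 p3]] unfolding x eq by simp
  qed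
  then show "cluster_shape ?s' G'"
    unfolding cluster_shape_alt c12 using cl E(5) c G' x mon_nonzero by simp
qed

end



section \<open>The variables \<open>X\<^sub>m\<close>\<close>

text \<open>Minus the g-vector of X_k, for the grading where X_i has degree e_i and y_j minus the
  j-th column of the upper exchange matrix. The branches differ because X_0, X_{-1}, X_{-2} have the
  weights of X_3, X_2, X_1 negated.\<close>

definition g_vec :: "int \<Rightarrow> nat \<Rightarrow> int" where
  "g_vec k j = (if 1 \<le> k then [k div 2 - 1, k mod 2 - 1, 1 - k mod 2 - k div 2] ! (j - 1)
     else [(- k) div 2, (- k) mod 2, 1 - (- k) mod 2 - (- k) div 2] ! (j - 1))"

text \<open>Frozen exponents in the exchange of X_k for X_{k+3}, k >= 1; raising k by 2 adds (1, 1,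
  1).\<close>

definition p_vec :: "int \<Rightarrow> nat \<Rightarrow> int" where
  "p_vec k j = [k div 2 + k mod 2, k div 2, k div 2 - 1 + k mod 2] ! (j - 1)"

text \<open>Frozen exponents in the exchange of X_{2-k} for X_{-k-1}, k >= 2.\<close>

definition n_vec :: "int \<Rightarrow> nat \<Rightarrow> int" where
  "n_vec k j = [k div 2 - 1, k div 2 - 1 + k mod 2, k div 2] ! (j - 1)"

definition G_mat :: "int \<Rightarrow> nat \<Rightarrow> nat \<Rightarrow> int" where
  "G_mat m i j = g_vec (m + int i - 1) j"

text \<open>The columns are the c-vectors of Sigma_m. The three steps down from m = 1 negate the
  unit vectors one at a time; m = 0 and m = -1 are transitional, and at m = -2 the matrix is minus
  the identity.\<close>

definition C_mat :: "int \<Rightarrow> nat \<Rightarrow> nat \<Rightarrow> int" where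
  "C_mat m j i =
     (if 1 \<le> m then
        [p_vec m j, [1 - m mod 2, m mod 2, 1 - m mod 2] ! (j - 1), - p_vec (m - 1) j]
      else if m = 0 then [[0, 0, -1] ! (j - 1), [1, 0, 0] ! (j - 1), [0, 1, 0] ! (j - 1)]
      else if m = - 1 then [[0, -1, 0] ! (j - 1), [0, 0, -1] ! (j - 1), [1, 0, 0] ! (j - 1)]
      else [n_vec (- m - 1) j, - [(- m) mod 2, 1 - (- m) mod 2, (- m) mod 2] ! (j - 1), - n_vec (- m) j]) ! (i - 1)"

lemma g_vec_nonpos:
  assumes "k \<le> 0"
  shows "g_vec k (Suc 0) = (- k) div 2" "g_vec k 2 = (- k) mod 2" "g_vec k 3 = 1 - (- k) mod 2 - (- k) div 2"
  using assms by (simp_all add: g_vec_def)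

lemma C_mat_neg:
  assumes "k \<le> - 2"
  shows "C_mat k j (Suc 0) = n_vec (- k - 1) j" "C_mat k j 2 = - [(- k) mod 2, 1 - (- k) mod 2, (- k) mod 2] ! (j - 1)"
    "C_mat k j 3 = - n_vec (- k) j"
  using assms by (simp_all add: C_mat_def)

lemma div_mod_2:
  fixes h :: int
  shows "(2 * h) div 2 = h" "(2 * h + 1) div 2 = h" "(2 * h + 2) div 2 = h + 1" "(2 * h + 3) div 2 = h + 1"
    "(2 * h - 1) div 2 = h - 1" "(2 * h - 2) div 2 = h - 1" "(2 * h - 3) div 2 = h - 2"
    "(2 * h) mod 2 = 0" "(2 * h + 1) mod 2 = 1" "(2 * h + 2) mod 2 = 0" "(2 * h + 3) mod 2 = 1"
    "(2 * h - 1) mod 2 = 1" "(2 * h - 2) mod 2 = 0" "(2 * h - 3) mod 2 = 1"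
  by presburger+

lemma parity_cases:
  obtains h :: int where "m = 2 * h" | h where "m = 2 * h + 1"
  by (metis evenE oddE)

lemma parity_cases_neg:
  obtains h :: int where "m = - (2 * h)" | h where "m = - (2 * h + 1)"
  by (metis evenE oddE minus_minus)

context quantum_torus_embedding
begin

section \<open>Closed form of the seeds Sigma_m\<close>

lemma Sigma_seed_up: "1 \<le> m \<Longrightarrow> Sigma_seed \<iota> (m + 1) = seed_up (sqrt_q \<iota>) (Sigma_seed \<iota> m)"
proof -
  assume "1 \<le> m"
  then have "nat (m + 1 - 1) = Suc (nat (m - 1))" by simp
  then show ?thesis using \<open>1 \<le> m\<close> by (simp add: Sigma_seed_def)
qed

lemma Sigma_seed_down: "m \<le> 1 \<Longrightarrow> Sigma_seed \<iota> (m - 1) = seed_down (sqrt_q \<iota>) (Sigma_seed \<iota> m)"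
proof -
  assume "m \<le> 1"
  then have "nat (1 - (m - 1)) = Suc (nat (1 - m))" by simp
  then show ?thesis using \<open>m \<le> 1\<close> by (auto simp add: Sigma_seed_def)
qed

lemma Sigma_shape_one:
  "seed_shape (Sigma_seed \<iota> 1) (G_mat 1) (C_mat 1)" "cluster_shape (Sigma_seed \<iota> 1) (G_mat 1)"
proof -
  have [simp]: "Sigma_seed \<iota> 1 = initial_seed \<iota>" by (simp add: Sigma_seed_def)
  show "seed_shape (Sigma_seed \<iota> 1) (G_mat 1) (C_mat 1)"
    by (simp add: seed_shape_def initial_seed_def lam_def Btilde_def G_mat_def C_mat_def g_vec_def p_vec_def yvar_def)
  have "\<iota> (Tor e a b c d f g) \<noteq> 0" for e a b c d f g
    using emb_inj[of "Tor e a b c d f g" 0] by (simp add: emb_zero Tor_def)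
  then show "cluster_shape (Sigma_seed \<iota> 1) (G_mat 1)"
    unfolding cluster_shape_alt qhom_def
    by (simp add: initial_seed_def basis_vec_Tor mon_def G_mat_def g_vec_def Tor_mult Tor_eq_iff emb_inj flip: emb_mult)
qed

lemma Sigma_step_up:
  assumes m: "1 \<le> m" and s: "seed_shape s (G_mat m) (C_mat m)" "cluster_shape s (G_mat m)"
  shows "seed_shape (seed_up (sqrt_q \<iota>) s) (G_mat (m + 1)) (C_mat (m + 1))"
   "clus (seed_up (sqrt_q \<iota>) s) 1 = clus s 2" "clus (seed_up (sqrt_q \<iota>) s) 2 = clus s 3"
    "clus s 1 * clus (seed_up (sqrt_q \<iota>) s) 3 = clus s 2 * clus s 3 + mon (-1) (p_vec m 1) (p_vec m 2) (p_vec m 3)"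
    "clus (seed_up (sqrt_q \<iota>) s) 3 * clus s 1 = clus s 2 * clus s 3 + mon 1 (p_vec m 1) (p_vec m 2) (p_vec m 3)"
    "cluster_shape (seed_up (sqrt_q \<iota>) s) (G_mat (m + 1))"
proof -
  have nn: "C_mat m 1 1 = p_vec m 1" "C_mat m 2 1 = p_vec m 2" "C_mat m 3 1 = p_vec m 3"
    using m by (simp_all add: C_mat_def)
  have pos: "0 \<le> p_vec m 1" "0 \<le> p_vec m 2" "0 \<le> p_vec m 3"
    using m by (cases m rule: parity_cases; simp add: p_vec_def)+
  have pos': "0 \<le> C_mat m 1 1" "0 \<le> C_mat m 2 1" "0 \<le> C_mat m 3 1"
    using pos nn by simp_all
  have G': "G_mat (m + 1) 1 j = G_mat m 2 j" "G_mat (m + 1) 2 j = G_mat m 3 j"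
      "G_mat (m + 1) 3 j = G_mat m 2 j + G_mat m 3 j - G_mat m 1 j" if "j \<in> {1, 2, 3}" for j
    using m that by (cases m rule: parity_cases; elim insertE emptyE; simp add: G_mat_def g_vec_def div_mod_2)+
  have C': "C_mat (m + 1) j 1 = C_mat m j 2 + C_mat m j 1" "C_mat (m + 1) j 2 = C_mat m j 3 + C_mat m j 1"
      "C_mat (m + 1) j 3 = - C_mat m j 1" if "j \<in> {1, 2, 3}" for j
    using m that by (cases m rule: parity_cases; elim insertE emptyE; simp add: C_mat_def p_vec_def div_mod_2)+
  have orth: "G_mat m 1 1 * p_vec m 1 + G_mat m 1 2 * p_vec m 2 + G_mat m 1 3 * p_vec m 3 = -1"
    "G_mat m 2 1 * p_vec m 1 + G_mat m 2 2 * p_vec m 2 + G_mat m 2 3 * p_vec m 3 = 0"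
    "G_mat m 3 1 * p_vec m 1 + G_mat m 3 2 * p_vec m 2 + G_mat m 3 3 * p_vec m 3 = 0"
    using m by (cases m rule: parity_cases; simp add: G_mat_def g_vec_def p_vec_def div_mod_2; simp add: algebra_simps)+
  have comp: "p_vec m 2 + p_vec m 3 = G_mat m 2 1 + G_mat m 3 1" "p_vec m 3 - p_vec m 1 = G_mat m 2 2 + G_mat m 3 2"
    "- p_vec m 1 - p_vec m 2 = G_mat m 2 3 + G_mat m 3 3"
    using m by (cases m rule: parity_cases; simp add: G_mat_def g_vec_def p_vec_def div_mod_2)+
  show "seed_shape (seed_up (sqrt_q \<iota>) s) (G_mat (m + 1)) (C_mat (m + 1))"
    using seed_shape_up[OF s(1) pos' G' C'] .
  show "clus (seed_up (sqrt_q \<iota>) s) 1 = clus s 2" "clus (seed_up (sqrt_q \<iota>) s) 2 = clus s 3"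
    "clus s 1 * clus (seed_up (sqrt_q \<iota>) s) 3 = clus s 2 * clus s 3 + mon (-1) (p_vec m 1) (p_vec m 2) (p_vec m 3)"
    "clus (seed_up (sqrt_q \<iota>) s) 3 * clus s 1 = clus s 2 * clus s 3 + mon 1 (p_vec m 1) (p_vec m 2) (p_vec m 3)"
    "cluster_shape (seed_up (sqrt_q \<iota>) s) (G_mat (m + 1))"
    using step_up[OF s nn pos G' orth comp] by simp_all
qed

lemma Sigma_step_down_nonpos:
  assumes m: "m \<le> - 2" and s: "seed_shape s (G_mat m) (C_mat m)" "cluster_shape s (G_mat m)"
  defines "n \<equiv> \<lambda>j. n_vec (- m) j"
  shows "seed_shape (seed_down (sqrt_q \<iota>) s) (G_mat (m - 1)) (C_mat (m - 1))"
    "clus (seed_down (sqrt_q \<iota>) s) 2 = clus s 1" "clus (seed_down (sqrt_q \<iota>) s) 3 = clus s 2"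
    "clus s 3 * clus (seed_down (sqrt_q \<iota>) s) 1 = clus s 1 * clus s 2 + mon 1 (n 1) (n 2) (n 3)"
    "clus (seed_down (sqrt_q \<iota>) s) 1 * clus s 3 = clus s 1 * clus s 2 + mon (-1) (n 1) (n 2) (n 3)"
    "cluster_shape (seed_down (sqrt_q \<iota>) s) (G_mat (m - 1))"
proof -
  have nn: "C_mat m 1 3 = - n 1" "C_mat m 2 3 = - n 2" "C_mat m 3 3 = - n 3"
    using m by (simp_all add: C_mat_def n_def)
  have pos: "0 \<le> n 1" "0 \<le> n 2" "0 \<le> n 3"
    using m by (cases m rule: parity_cases_neg; simp add: n_def n_vec_def div_mod_2)+
  have G': "G_mat (m - 1) 1 j = G_mat m 1 j + G_mat m 2 j - G_mat m 3 j" "G_mat (m - 1) 2 j = G_mat m 1 j"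
      "G_mat (m - 1) 3 j = G_mat m 2 j" if "j \<in> {1, 2, 3}" for j
    using m that by (cases m rule: parity_cases_neg; elim insertE emptyE; simp add: G_mat_def g_vec_nonpos div_mod_2)+
  have C': "C_mat (m - 1) j 1 = - C_mat m j 3" "C_mat (m - 1) j 2 = C_mat m j 1 + C_mat m j 3"
      "C_mat (m - 1) j 3 = C_mat m j 2 + C_mat m j 3" if "j \<in> {1, 2, 3}" for j
    using m that by (cases m rule: parity_cases_neg; elim insertE emptyE; simp add: C_mat_neg n_vec_def div_mod_2)+
  have orth: "G_mat m 3 1 * n 1 + G_mat m 3 2 * n 2 + G_mat m 3 3 * n 3 = 1"
    "G_mat m 1 1 * n 1 + G_mat m 1 2 * n 2 + G_mat m 1 3 * n 3 = 0"
    "G_mat m 2 1 * n 1 + G_mat m 2 2 * n 2 + G_mat m 2 3 * n 3 = 0"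
    using m by (cases m rule: parity_cases_neg; simp add: n_def G_mat_def g_vec_nonpos n_vec_def div_mod_2; simp add: algebra_simps)+
  have comp: "n 2 + n 3 = G_mat m 1 1 + G_mat m 2 1" "n 3 - n 1 = G_mat m 1 2 + G_mat m 2 2"
    "- n 1 - n 2 = G_mat m 1 3 + G_mat m 2 3"
    using m by (cases m rule: parity_cases_neg; simp add: n_def G_mat_def g_vec_nonpos n_vec_def div_mod_2)+
  show "seed_shape (seed_down (sqrt_q \<iota>) s) (G_mat (m - 1)) (C_mat (m - 1))"
    using seed_shape_down_nonpos[OF s(1) nn pos G' C' orth(2,3) comp] .
  show 
    "clus (seed_down (sqrt_q \<iota>) s) 2 = clus s 1" "clus (seed_down (sqrt_q \<iota>) s) 3 = clus s 2"
    "clus s 3 * clus (seed_down (sqrt_q \<iota>) s) 1 = clus s 1 * clus s 2 + mon 1 (n 1) (n 2) (n 3)"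
    "clus (seed_down (sqrt_q \<iota>) s) 1 * clus s 3 = clus s 1 * clus s 2 + mon (-1) (n 1) (n 2) (n 3)"
    "cluster_shape (seed_down (sqrt_q \<iota>) s) (G_mat (m - 1))"
    using step_down_nonpos[OF s nn pos G' orth comp] by simp_all
qed


lemma Sigma_step_down_nonneg:
  assumes m: "m \<in> {1, 0, - 1}" and s: "seed_shape s (G_mat m) (C_mat m)" "cluster_shape s (G_mat m)"
  defines "c \<equiv> \<lambda>j. C_mat m j 3"
  shows "seed_shape (seed_down (sqrt_q \<iota>) s) (G_mat (m - 1)) (C_mat (m - 1))"
    "clus (seed_down (sqrt_q \<iota>) s) 2 = clus s 1" "clus (seed_down (sqrt_q \<iota>) s) 3 = clus s 2"
    "clus s 3 * clus (seed_down (sqrt_q \<iota>) s) 1 = clus s 1 * clus s 2 * mon (-1) (c 1) (c 2) (c 3) + 1"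
    "clus (seed_down (sqrt_q \<iota>) s) 1 * clus s 3 = clus s 1 * clus s 2 * mon 1 (c 1) (c 2) (c 3) + 1"
    "cluster_shape (seed_down (sqrt_q \<iota>) s) (G_mat (m - 1))"
proof -
  have nn: "C_mat m 1 3 = c 1" "C_mat m 2 3 = c 2" "C_mat m 3 3 = c 3"
    by (simp_all add: c_def)
  have pos: "0 \<le> c 1" "0 \<le> c 2" "0 \<le> c 3"
    using m by (elim insertE emptyE; simp add: c_def C_mat_def p_vec_def)+
  have pos': "0 \<le> C_mat m 1 3" "0 \<le> C_mat m 2 3" "0 \<le> C_mat m 3 3"
    using pos by (simp_all add: c_def)
  have G': "G_mat (m - 1) 1 j = - G_mat m 3 j" "G_mat (m - 1) 2 j = G_mat m 1 j"
      "G_mat (m - 1) 3 j = G_mat m 2 j" if "j \<in> {1, 2, 3}" for j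
    using m that by (elim insertE emptyE; simp add: G_mat_def g_vec_def)+
  have C': "C_mat (m - 1) j 1 = - C_mat m j 3" "C_mat (m - 1) j 2 = C_mat m j 1"
      "C_mat (m - 1) j 3 = C_mat m j 2" if "j \<in> {1, 2, 3}" for j
    using m that by (elim insertE emptyE; simp add: C_mat_def p_vec_def n_vec_def)+
  have orth: "G_mat m 3 1 * c 1 + G_mat m 3 2 * c 2 + G_mat m 3 3 * c 3 = -1"
    "G_mat m 1 1 * c 1 + G_mat m 1 2 * c 2 + G_mat m 1 3 * c 3 = 0"
    "G_mat m 2 1 * c 1 + G_mat m 2 2 * c 2 + G_mat m 2 3 * c 3 = 0"
    using m by (elim insertE emptyE; simp add: c_def C_mat_def p_vec_def G_mat_def g_vec_def)+
  have comp: "- c 2 - c 3 = G_mat m 1 1 + G_mat m 2 1" "c 1 - c 3 = G_mat m 1 2 + G_mat m 2 2"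
    "c 1 + c 2 = G_mat m 1 3 + G_mat m 2 3"
    using m by (elim insertE emptyE; simp add: c_def C_mat_def p_vec_def G_mat_def g_vec_def)+
  show "seed_shape (seed_down (sqrt_q \<iota>) s) (G_mat (m - 1)) (C_mat (m - 1))"
    using seed_shape_down_nonneg[OF s(1) pos' G' C'] .
  show "clus (seed_down (sqrt_q \<iota>) s) 2 = clus s 1" "clus (seed_down (sqrt_q \<iota>) s) 3 = clus s 2"
    "clus s 3 * clus (seed_down (sqrt_q \<iota>) s) 1 = clus s 1 * clus s 2 * mon (-1) (c 1) (c 2) (c 3) + 1"
    "clus (seed_down (sqrt_q \<iota>) s) 1 * clus s 3 = clus s 1 * clus s 2 * mon 1 (c 1) (c 2) (c 3) + 1"
    "cluster_shape (seed_down (sqrt_q \<iota>) s) (G_mat (m - 1))"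
    using step_down_nonneg[OF s nn pos G' orth comp] by simp_all
qed

lemma Sigma_shape: "seed_shape (Sigma_seed \<iota> m) (G_mat m) (C_mat m) \<and> cluster_shape (Sigma_seed \<iota> m) (G_mat m)"
proof (cases "1 \<le> m")
  case True
  then show ?thesis
  proof (induction m rule: int_ge_induct)
    case base
    then show ?case using Sigma_shape_one by simp
  next
    case (step i)
    then show ?case using Sigma_step_up(1,6)[of i] by (simp add: Sigma_seed_up)
  qed
next
  case False
  then have "m \<le> 1" by simp
  then show ?thesis
  proof (induction m rule: int_le_induct)
    case base
    then show ?case using Sigma_shape_one by simp
  next
    case (step i)
    consider "i \<in> {1, 0, -1}" | "i \<le> - 2" using step(1) by fastforce
    then show ?case
      using step Sigma_step_down_nonneg(1,6)[of i] Sigma_step_down_nonpos(1,6)[of i]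
      by cases (auto simp: Sigma_seed_down)
  qed
qed

lemmas Sigma_shapes = Sigma_shape[THEN conjunct1] Sigma_shape[THEN conjunct2]

abbreviation X :: "int \<Rightarrow> 'f" where "X \<equiv> Xvar \<iota>"

text \<open>\<open>Sigma_seed\<close> is built outwards from 1, so the variables shared by
  neighbouring seeds come from the step up for m >= 1 and from the step down for m <= 0.\<close>

lemma clus_Sigma: "clus (Sigma_seed \<iota> m) 1 = X m" "clus (Sigma_seed \<iota> m) 2 = X (m + 1)"
  "clus (Sigma_seed \<iota> m) 3 = X (m + 2)"
proof -
  show 1: "clus (Sigma_seed \<iota> m) 1 = X m" for m
    by (simp add: Xvar_def)
  have shift: "clus (Sigma_seed \<iota> m) 2 = clus (Sigma_seed \<iota> (m + 1)) 1 \<and>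
      clus (Sigma_seed \<iota> m) 3 = clus (Sigma_seed \<iota> (m + 1)) 2" for m
  proof -
    consider "1 \<le> m" | "m + 1 \<in> {1, 0, -1}" | "m + 1 \<le> - 2" by fastforce
    then show ?thesis
    proof cases
      case 1
      then show ?thesis using Sigma_step_up(2,3)[OF 1 Sigma_shapes] Sigma_seed_up[OF 1] by simp
    next
      case 2
      then have "m + 1 \<le> 1" by auto
      then show ?thesis using Sigma_step_down_nonneg(2,3)[OF 2 Sigma_shapes] Sigma_seed_down[of "m + 1"] by simp
    next
      case 3
      then have "m + 1 \<le> 1" by auto
      then show ?thesis using Sigma_step_down_nonpos(2,3)[OF 3 Sigma_shapes] Sigma_seed_down[of "m + 1"] by simp
    qed
  qed
  show 2: "clus (Sigma_seed \<iota> m) 2 = X (m + 1)" for m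
    using shift[of m] 1 by simp
  show "clus (Sigma_seed \<iota> m) 3 = X (m + 2)"
    using shift[of m] 2[of "m + 1"] by (simp add: add.commute)
qed

section \<open>Commutation and exchange relations of the X_m\<close>

lemma X_nonzero: "X m \<noteq> 0"
  and X_hom: "qhom (X m) (g_vec m 1) (g_vec m 2) (g_vec m 3)"
  and X_commute: "X m * X (m + 1) = X (m + 1) * X m" "X m * X (m + 2) = X (m + 2) * X m"
  using Sigma_shapes(2)[of m] unfolding cluster_shape_alt clus_Sigma by (simp_all add: G_mat_def)

lemma X_exchange_pos:
  assumes "1 \<le> m"
  shows "X m * X (m + 3) = X (m + 1) * X (m + 2) + mon (-1) (p_vec m 1) (p_vec m 2) (p_vec m 3)"
    "X (m + 3) * X m = X (m + 1) * X (m + 2) + mon 1 (p_vec m 1) (p_vec m 2) (p_vec m 3)"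
  using Sigma_step_up(4,5)[OF assms Sigma_shapes] unfolding clus_Sigma Sigma_seed_up[OF assms, symmetric]
  by (simp_all add: add.assoc)

text \<open>The three exchanges of X_3, X_2, X_1 for X_0, X_{-1}, X_{-2}. Their frozen column is
  nonnegative although they go down, so the monomial sits on the product term.\<close>

lemma X_exchange_mid:
  assumes "m \<in> {0, - 1, - 2}"
  shows "X m * X (m + 3) = X (m + 1) * X (m + 2) * mon 1 (C_mat (m + 1) 1 3) (C_mat (m + 1) 2 3) (C_mat (m + 1) 3 3) + 1"
    "X (m + 3) * X m = X (m + 1) * X (m + 2) * mon (-1) (C_mat (m + 1) 1 3) (C_mat (m + 1) 2 3) (C_mat (m + 1) 3 3) + 1"
proof -
  have *: "m + 1 \<in> {1, 0, -1}" "m + 1 \<le> 1" using assms by auto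
  have d: "seed_down (sqrt_q \<iota>) (Sigma_seed \<iota> (m + 1)) = Sigma_seed \<iota> m"
    using Sigma_seed_down[OF *(2)] by simp
  show "X m * X (m + 3) = X (m + 1) * X (m + 2) * mon 1 (C_mat (m + 1) 1 3) (C_mat (m + 1) 2 3) (C_mat (m + 1) 3 3) + 1"
    "X (m + 3) * X m = X (m + 1) * X (m + 2) * mon (-1) (C_mat (m + 1) 1 3) (C_mat (m + 1) 2 3) (C_mat (m + 1) 3 3) + 1"
    using Sigma_step_down_nonneg(4,5)[OF *(1) Sigma_shapes] unfolding d clus_Sigma by (simp_all add: add.assoc)
qed

lemma X_exchange_neg:
  assumes "m \<le> - 3"
  shows "X m * X (m + 3) = X (m + 1) * X (m + 2) + mon (-1) (n_vec (- m - 1) 1) (n_vec (- m - 1) 2) (n_vec (- m - 1) 3)"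
    "X (m + 3) * X m = X (m + 1) * X (m + 2) + mon 1 (n_vec (- m - 1) 1) (n_vec (- m - 1) 2) (n_vec (- m - 1) 3)"
proof -
  have *: "m + 1 \<le> - 2" "m + 1 \<le> 1" using assms by auto
  have d: "seed_down (sqrt_q \<iota>) (Sigma_seed \<iota> (m + 1)) = Sigma_seed \<iota> m"
    using Sigma_seed_down[OF *(2)] by simp
  show "X m * X (m + 3) = X (m + 1) * X (m + 2) + mon (-1) (n_vec (- m - 1) 1) (n_vec (- m - 1) 2) (n_vec (- m - 1) 3)"
    "X (m + 3) * X m = X (m + 1) * X (m + 2) + mon 1 (n_vec (- m - 1) 1) (n_vec (- m - 1) 2) (n_vec (- m - 1) 3)"
    using Sigma_step_down_nonpos(4,5)[OF *(1) Sigma_shapes] unfolding d clus_Sigma by (simp_all add: add.assoc)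
qed


subsection \<open>Multiplication by \<open>u\<^sub>1\<close>\<close>

abbreviation u :: 'f where "u \<equiv> \<iota> u1_elt"

lemma X_initial: "X 1 = \<iota> (Tor 0 1 0 0 0 0 0)" "X 2 = \<iota> (Tor 0 0 1 0 0 0 0)" "X 3 = \<iota> (Tor 0 0 0 1 0 0 0)"
  using clus_Sigma[of 1] by (simp_all add: Sigma_seed_def initial_seed_def basis_vec_Tor)

lemma X_4: "X 4 = \<iota> (Tor 0 (-1) 0 0 1 0 0 + Tor 0 (-1) 1 1 0 0 0)"
proof -
  have "X 1 * X 4 = X 1 * \<iota> (Tor 0 (-1) 0 0 1 0 0 + Tor 0 (-1) 1 1 0 0 0)"
    using X_exchange_pos(1)[of 1]
    by (simp add: X_initial mon_def p_vec_def Tor_mult distrib_left add.commute flip: emb_mult emb_add)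
  then show ?thesis using X_nonzero[of 1] by simp
qed

lemma X_0: "X 0 = \<iota> (Tor 0 1 1 (-1) 0 0 1 + Tor 0 0 0 (-1) 0 0 0)"
proof -
  have "X 3 * X 0 = X 3 * \<iota> (Tor 0 1 1 (-1) 0 0 1 + Tor 0 0 0 (-1) 0 0 0)"
    using X_exchange_mid(2)[of 0]
    by (simp add: X_initial mon_def C_mat_def p_vec_def Tor_mult distrib_left one_Tor flip: emb_mult emb_add emb_one)
  then show ?thesis using X_nonzero[of 3] by simp
qed

text \<open>This is S_k, and \<open>coeff_minus\<close> is T_k. The exponents of
  \<open>coeff_plus (k - 2)\<close> and \<open>coeff_minus k\<close> always add up to (1, 1, 1), the
  exponent in the recursion of u_n; for k = 1 and k = 2 they are shared between the two.\<close>

definition coeff_plus :: "int \<Rightarrow> 'f" where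
  "coeff_plus k = (if 1 \<le> k then 1 else if k = 0 then mon (-1) 0 0 1 else if k = -1 then mon (-1) 0 1 1 else mon (-2) 1 1 1)"

definition coeff_minus :: "int \<Rightarrow> 'f" where
  "coeff_minus k = (if k \<le> 0 then 1 else if k = 1 then mon 1 1 0 0 else if k = 2 then mon 1 1 1 0 else mon 2 1 1 1)"

lemma u_X_2: "u * X 2 = X 4 + X 0 * coeff_minus 2"
  by (simp add: X_initial X_4 X_0 coeff_minus_def mon_def u1_Tor_X2 flip: emb_mult emb_add)

text \<open>Conjugating the formula for \<open>w * x\<close> by \<open>x\<close> gives one for \<open>x * w\<close>, which is then multiplied by \<open>x'\<close>.\<close>

lemma recurrence_transfer:
  fixes x :: 'f
  assumes "w * x = a * p + b * q" "x \<noteq> 0" and comm: "x * a = a * x" "x * b = b * x"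
    and "x * p = p' * x" "x * q = q' * x" and pq: "p' * x' = x' * p''" "q' * x' = x' * q''"
    and z: "x * z = a * (x' * p'') + b * (x' * q'')"
  shows "w * x' = z"
proof -
  have "x * w * x = (a * p' + b * q') * x"
  proof -
    have "x * w * x = (x * a) * p + (x * b) * q"
      using assms(1) by (simp add: mult.assoc distrib_left)
    also have "\<dots> = a * (x * p) + b * (x * q)"
      unfolding comm by (simp add: mult.assoc)
    also have "\<dots> = (a * p' + b * q') * x"
      unfolding assms(5,6) by (simp add: mult.assoc distrib_right)
    finally show ?thesis .
  qed
  then have "x * w = a * p' + b * q'"
    using \<open>x \<noteq> 0\<close> by simp
  then have "x * (w * x') = a * (p' * x') + b * (q' * x')"
    by (simp add: mult.assoc distrib_right flip: mult.assoc[of x])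
  also have "\<dots> = x * z"
    unfolding pq z ..
  finally show ?thesis using \<open>x \<noteq> 0\<close> by simp
qed

lemma X_commute': "X m * X (m - 1) = X (m - 1) * X m" "X m * X (m - 2) = X (m - 2) * X m"
  using X_commute(1)[of "m - 1"] X_commute(2)[of "m - 2"] by simp_all

definition g_shift :: "int \<Rightarrow> int \<Rightarrow> int \<Rightarrow> int \<Rightarrow> int" where
  "g_shift k a b c = 2 * (g_vec k 1 * a + g_vec k 2 * b + g_vec k 3 * c)"

lemma X_mon: "X k * mon e a b c = mon (e + g_shift k a b c) a b c * X k"
  unfolding g_shift_def using qhomD[OF X_hom] .

lemma mon_X: "mon e a b c * X k = X k * mon (e - g_shift k a b c) a b c"
  unfolding g_shift_def using qhomD'[OF X_hom] .

text \<open>Conjugation by X_k adds \<open>g_shift k\<close> to the exponent of q, and passing X_l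
  subtracts \<open>g_shift l\<close>. It is applied with l = k + 1 and l = k - 1.\<close>

lemma X_recurrence_step:
  assumes R: "u * X k = X (k + 2) * mon e a b c + X (k - 2) * mon e' a' b' c'"
    and z: "X k * z = X (k + 2) * (X l * mon (e + g_shift k a b c - g_shift l a b c) a b c) +
       X (k - 2) * (X l * mon (e' + g_shift k a' b' c' - g_shift l a' b' c') a' b' c')"
  shows "u * X l = z"
  by (rule recurrence_transfer[OF R X_nonzero X_commute(2) X_commute'(2) X_mon X_mon mon_X mon_X z])

lemma recurrence_up:
  assumes "2 \<le> k" and R: "u * X k = X (k + 2) + X (k - 2) * coeff_minus k"
  shows "u * X (k + 1) = X (k + 3) + X (k - 1) * coeff_minus (k + 1)"
proof -
  have sh: "g_shift k 0 0 0 = 0" for k by (simp add: g_shift_def)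
  have c: "X (k + 2) * X (k + 1) = X (k + 1) * X (k + 2)" "X (k - 1) * X k = X k * X (k - 1)"
    using X_commute(1)[of "k + 1"] X_commute(1)[of "k - 1"] by (simp_all add: add.assoc)
  show ?thesis
  proof (cases "k = 2")
    case True
    have 1: "X 2 * X 5 = X 3 * X 4 + mon (-1) 1 1 0"
      using X_exchange_pos(1)[of 2] by (simp add: p_vec_def)
    have 2: "X 0 * X 3 = X 1 * X 2 * mon 1 0 0 1 + 1"
      using X_exchange_mid(1)[of 0] by (simp add: C_mat_def p_vec_def)
    \<comment> \<open>\<open>mon (-1) 1 1 0\<close> is \<open>coeff_minus 2\<close> after the
      transfer: X_2 contributes -2 and X_3 contributes 0.\<close>
    have "X 2 * (X 5 + X 1 * coeff_minus 3) = X 4 * (X 3 * mon 0 0 0 0) + X 0 * (X 3 * mon (-1) 1 1 0)"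
      using 1 2 c True by (simp add: coeff_minus_def mon_one distrib_left distrib_right mon_mult flip: mult.assoc)
        (simp add: mult.assoc mon_mult)
    then show ?thesis
      using X_recurrence_step[of 2 0 0 0 0 1 1 1 0 "X 5 + X 1 * coeff_minus 3" 3] R True
      by (simp add: coeff_minus_def mon_one g_shift_def g_vec_def)
  next
    case False
    then have k: "3 \<le> k" using assms by simp
    have 1: "X k * X (k + 3) = X (k + 1) * X (k + 2) + mon (-1) (p_vec k 1) (p_vec k 2) (p_vec k 3)"
      using X_exchange_pos(1)[of k] k by simp
    have 2: "X (k - 2) * X (k + 1) = X (k - 1) * X k + mon (-1) (p_vec (k - 2) 1) (p_vec (k - 2) 2) (p_vec (k - 2) 3)"
      using X_exchange_pos(1)[of "k - 2"] k by (simp add: add.commute)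
    \<comment> \<open>The exponent 2 makes up for the twist -2 from the product, which is constant
      because the third entry of \<open>p_vec\<close> is always the first minus 1.\<close>
    have 3: "mon (-1) (p_vec (k - 2) 1) (p_vec (k - 2) 2) (p_vec (k - 2) 3) * mon 2 1 1 1 =
        mon (-1) (p_vec k 1) (p_vec k 2) (p_vec k 3)"
      unfolding mon_mult mon_eq_iff by (cases k rule: parity_cases) (simp_all add: p_vec_def div_mod_2)
    have "X k * (X (k + 3) + X (k - 1) * coeff_minus (k + 1)) = X (k + 2) * (X (k + 1) * mon 0 0 0 0) + X (k - 2) * (X (k + 1) * mon 2 1 1 1)"
      using 1 2 3 c k by (simp add: coeff_minus_def mon_one distrib_left distrib_right flip: mult.assoc)
    \<comment> \<open>For k >= 1 the weights of X_k sum to -1, so the transfer leaves the exponent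
      of q unchanged.\<close>
    moreover have "g_shift k 1 1 1 = g_shift (k + 1) 1 1 1"
      using k by (simp add: g_shift_def g_vec_def)
    ultimately show ?thesis
      using X_recurrence_step[of k 0 0 0 0 2 1 1 1 "X (k + 3) + X (k - 1) * coeff_minus (k + 1)" "k + 1"] R k
      by (simp add: coeff_minus_def mon_one sh)
  qed
qed

text \<open>From k = -2 downwards both relations used, for X_{k+2} X_{k-1} and X_k X_{k-3}, come
  from nonpositive columns.\<close>

lemma recurrence_down_neg:
  assumes k: "k \<le> - 2" and R: "u * X k = X (k + 2) * coeff_plus k + X (k - 2)"
  shows "u * X (k - 1) = X (k + 1) * coeff_plus (k - 1) + X (k - 3)"
proof -
  have sh: "g_shift k 0 0 0 = 0" for k by (simp add: g_shift_def)
  have c: "X (k - 2) * X (k - 1) = X (k - 1) * X (k - 2)" "X (k + 1) * X k = X k * X (k + 1)"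
    using X_commute(1)[of "k - 2"] X_commute(1)[of "k"] by (simp_all add: add.assoc)
  have 1: "X k * X (k - 3) = X (k - 2) * X (k - 1) + mon 1 (n_vec (2 - k) 1) (n_vec (2 - k) 2) (n_vec (2 - k) 3)"
    using X_exchange_neg(2)[of "k - 3"] k by simp
  have 2: "X (k + 2) * X (k - 1) = X k * X (k + 1) + mon 1 (n_vec (- k) 1) (n_vec (- k) 2) (n_vec (- k) 3)"
    using X_exchange_neg(2)[of "k - 1"] k by (simp add: add.commute)
  have 3: "mon 1 (n_vec (- k) 1) (n_vec (- k) 2) (n_vec (- k) 3) * mon (-2) 1 1 1 =
      mon 1 (n_vec (2 - k) 1) (n_vec (2 - k) 2) (n_vec (2 - k) 3)"
    unfolding mon_mult mon_eq_iff by (cases k rule: parity_cases_neg) (simp_all add: n_vec_def div_mod_2)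
  have "X k * (X (k + 1) * coeff_plus (k - 1) + X (k - 3)) = X (k + 2) * (X (k - 1) * mon (-2) 1 1 1) + X (k - 2) * (X (k - 1) * mon 0 0 0 0)"
    using 1 2 3 c k by (simp add: coeff_plus_def mon_one distrib_left distrib_right flip: mult.assoc)
  moreover have "g_shift k 1 1 1 = g_shift (k - 1) 1 1 1"
    using k by (simp add: g_shift_def g_vec_def)
  ultimately show ?thesis
    using X_recurrence_step[of k "-2" 1 1 1 0 0 0 0 "X (k + 1) * coeff_plus (k - 1) + X (k - 3)" "k - 1"] R k
    by (simp add: coeff_plus_def mon_one sh)
qed

lemma X_exchange_special:
  "X 2 * X (- 1) = X 0 * X 1 * mon (-1) 0 1 0 + 1" "X 4 * X 1 = X 2 * X 3 + mon 1 1 0 0"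
  "X 1 * X (- 2) = X (- 1) * X 0 * mon (-1) 1 0 0 + 1" "X 3 * X 0 = X 1 * X 2 * mon (-1) 0 0 1 + 1"
  "X 0 * X (- 3) = X (- 2) * X (- 1) + mon 1 0 0 1" "X (- 1) * X (- 4) = X (- 3) * X (- 2) + mon 1 0 1 1"
  using X_exchange_mid(2)[of "- 1"] X_exchange_pos(2)[of 1] X_exchange_mid(2)[of "- 2"] X_exchange_mid(2)[of 0]
    X_exchange_neg(2)[of "- 3"] X_exchange_neg(2)[of "- 4"]
  by (simp_all add: C_mat_def p_vec_def n_vec_def)

text \<open>Descent from k = 2 to k = -2. Each transfer meets at least one of the three relations of
  \<open>X_exchange_mid\<close>.\<close>

lemma recurrence_special:
  "u * X 1 = X 3 + X (- 1) * mon 1 1 0 0"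
  "u * X 0 = X 2 * mon (-1) 0 0 1 + X (- 2)"
  "u * X (- 1) = X 1 * mon (-1) 0 1 1 + X (- 3)"
  "u * X (- 2) = X 0 * mon (-2) 1 1 1 + X (- 4)"
proof -
  have mon0: "x * mon 0 0 0 0 = x" for x by (simp add: mon_one)
  note shift = g_shift_def g_vec_def mon0
  note ring = distrib_left distrib_right mult.assoc[symmetric] X_exchange_special mon0
  note ring' = mult.assoc mon_mult
  show 1: "u * X 1 = X 3 + X (- 1) * mon 1 1 0 0"
  proof (rule X_recurrence_step[of 2 0 0 0 0 1 1 1 0])
    show "u * X 2 = X (2 + 2) * mon 0 0 0 0 + X (2 - 2) * mon 1 1 1 0"
      using u_X_2 by (simp add: coeff_minus_def mon0)
  qed (simp add: shift, simp add: ring, simp add: ring')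
  show 2: "u * X 0 = X 2 * mon (-1) 0 0 1 + X (- 2)"
  proof (rule X_recurrence_step[of 1 0 0 0 0 1 1 0 0])
    show "u * X 1 = X (1 + 2) * mon 0 0 0 0 + X (1 - 2) * mon 1 1 0 0"
      using 1 by (simp add: mon0)
  qed (simp add: shift, simp add: ring)
  show 3: "u * X (- 1) = X 1 * mon (-1) 0 1 1 + X (- 3)"
  proof (rule X_recurrence_step[of 0 "-1" 0 0 1 0 0 0 0])
    show "u * X 0 = X (0 + 2) * mon (-1) 0 0 1 + X (0 - 2) * mon 0 0 0 0"
      using 2 by (simp add: mon0)
  qed (simp add: shift, simp add: ring, simp add: ring')
  show "u * X (- 2) = X 0 * mon (-2) 1 1 1 + X (- 4)"
  proof (rule X_recurrence_step[of "- 1" "-1" 0 1 1 0 0 0 0])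
    show "u * X (- 1) = X (- 1 + 2) * mon (-1) 0 1 1 + X (- 1 - 2) * mon 0 0 0 0"
      using 3 by (simp add: mon0)
  qed (simp add: shift, simp add: ring, simp add: ring')
qed

lemma recurrence: "u * X k = X (k + 2) * coeff_plus k + X (k - 2) * coeff_minus k"
proof -
  consider "2 \<le> k" | "k = 1" | "k = 0" | "k = - 1" | "k \<le> - 2" by linarith
  then show ?thesis
  proof cases
    case 1
    then have "u * X k = X (k + 2) + X (k - 2) * coeff_minus k"
    proof (induction k rule: int_ge_induct)
      case base
      then show ?case using u_X_2 by simp
    next
      case (step i)
      then show ?case using recurrence_up[of i] by (simp add: add.commute)
    qed
    then show ?thesis using 1 by (simp add: coeff_plus_def)
  next
    case 5
    then have "u * X k = X (k + 2) * coeff_plus k + X (k - 2)"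
    proof (induction k rule: int_le_induct)
      case base
      then show ?case using recurrence_special(4) by (simp add: coeff_plus_def)
    next
      case (step i)
      then show ?case using recurrence_down_neg[of i] by (simp add: add.commute)
    qed
    then show ?thesis using 5 by (simp add: coeff_minus_def)
  qed (use recurrence_special in \<open>simp_all add: coeff_plus_def coeff_minus_def\<close>)
qed


subsection \<open>Multiplication by \<open>u\<^sub>n\<close>\<close>

text \<open>With the value 2 instead of 1 at \<open>n = 0\<close> the recursion for \<open>u\<^sub>n\<close> holds from the start.\<close>

definition U :: "nat \<Rightarrow> 'f" where
  "U n = (if n = 0 then 2 else \<iota> (u_elt n))"

lemma U_rec: "U (Suc (Suc n)) = u * U (Suc n) - mon 0 1 1 1 * U n"
proof (cases n)
  case 0
  have "\<iota> (2 * x) = \<iota> x * 2" for x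
    by (simp add: mult_2 mult_2_right emb_add)
  then show ?thesis
    by (simp add: 0 U_def emb_diff emb_mult power2_eq_square mon_def qX_Tor)
next
  case (Suc k)
  then show ?thesis
    by (simp add: U_def emb_diff emb_mult mon_def qX_Tor)
qed

text \<open>Closed form of the product of \<open>coeff_plus\<close> over k, k + 2, ..., k + 2n - 2,
  later factors on the left. Factors at positive indices are 1, so the value no longer depends on n
  once k + 2n > 0. \<open>coeff_minus_iter\<close> is the analogue over k, k - 2, ....\<close>

definition coeff_plus_iter :: "int \<Rightarrow> nat \<Rightarrow> 'f" where
  "coeff_plus_iter k n = (if 1 \<le> k then 1
     else if k \<le> - 2 * int n then mon (- 2 * int n) (int n) (int n) (int n)
     else mon (-1) ((- k) div 2) ((1 - k) div 2) ((- k) div 2 + 1))"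

definition coeff_minus_iter :: "int \<Rightarrow> nat \<Rightarrow> 'f" where
  "coeff_minus_iter k n = (if k \<le> 0 then 1
     else if 2 * int n + 1 \<le> k then mon (2 * int n) (int n) (int n) (int n)
     else mon 1 ((k + 1) div 2) (k div 2) ((k + 1) div 2 - 1))"

lemma coeff_iter_zero: "coeff_plus_iter k 0 = 1" "coeff_minus_iter k 0 = 1"
  by (simp_all add: coeff_plus_iter_def coeff_minus_iter_def mon_one)

lemma coeff_iter_one: "coeff_plus_iter k (Suc 0) = coeff_plus k" "coeff_minus_iter k (Suc 0) = coeff_minus k"
proof -
  consider "k \<le> - 2" | "k = - 1" | "k = 0" | "k = 1" | "k = 2" | "3 \<le> k" by linarith
  then show "coeff_plus_iter k (Suc 0) = coeff_plus k" "coeff_minus_iter k (Suc 0) = coeff_minus k"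
    by (cases; simp add: coeff_plus_iter_def coeff_minus_iter_def coeff_plus_def coeff_minus_def)+
qed

lemma g_shift_111: "g_shift k 1 1 1 = (if 1 \<le> k then - 2 else 2)"
  by (simp add: g_shift_def g_vec_def)

text \<open>The first equation adds a factor to the product. The second concerns a step down from j
  = k - 2n and back up: it returns to X_j with exactly the monomial that arises when
  \<open>mon 0 1 1 1\<close> is moved past X_j.\<close>

lemma coeff_plus_mult_iter:
  "coeff_plus (k + 2 * int n + 2) * coeff_plus_iter k (Suc n) = coeff_plus_iter k (Suc (Suc n))"
  "coeff_plus (k - 2 * int n - 2) * coeff_minus_iter k (Suc n) = mon (- g_shift (k - 2 * int n) 1 1 1) 1 1 1 * coeff_minus_iter k n"
proof -
  consider "k + 2 * int n + 2 \<le> - 2" | "k = - (2 * int n + 3)" | "k = - (2 * int n + 2)" | "- (2 * int n + 2) < k" "k \<le> 0" | "1 \<le> k"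
    by linarith
  then show "coeff_plus (k + 2 * int n + 2) * coeff_plus_iter k (Suc n) = coeff_plus_iter k (Suc (Suc n))"
    by cases (simp_all add: coeff_plus_def coeff_plus_iter_def mon_mult mon_eq_iff div_mod_2)
  consider "k \<le> 0" | "1 \<le> k" "k \<le> 2 * int n" | "k = 2 * int n + 1" | "k = 2 * int n + 2" | "3 \<le> k - 2 * int n"
    by linarith
  then show "coeff_plus (k - 2 * int n - 2) * coeff_minus_iter k (Suc n) = mon (- g_shift (k - 2 * int n) 1 1 1) 1 1 1 * coeff_minus_iter k n"
    unfolding g_shift_111 by cases (simp_all add: coeff_plus_def coeff_minus_iter_def mon_mult mon_eq_iff div_mod_2)
qed

lemma coeff_minus_mult_iter:
  "coeff_minus (k + 2 * int n + 2) * coeff_plus_iter k (Suc n) = mon (- g_shift (k + 2 * int n) 1 1 1) 1 1 1 * coeff_plus_iter k n"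
  "coeff_minus (k - 2 * int n - 2) * coeff_minus_iter k (Suc n) = coeff_minus_iter k (Suc (Suc n))"
proof -
  consider "k + 2 * int n + 2 \<le> 0" | "k = - (2 * int n + 1)" | "k = - (2 * int n)" | "- (2 * int n) < k" "k \<le> 0" | "1 \<le> k"
    by linarith
  then show "coeff_minus (k + 2 * int n + 2) * coeff_plus_iter k (Suc n) = mon (- g_shift (k + 2 * int n) 1 1 1) 1 1 1 * coeff_plus_iter k n"
    unfolding g_shift_111 by cases (simp_all add: coeff_minus_def coeff_plus_iter_def mon_mult mon_eq_iff div_mod_2)
  consider "k \<le> 0" | "1 \<le> k" "k \<le> 2 * int n + 2" | "k = 2 * int n + 3" | "k = 2 * int n + 4" | "5 \<le> k - 2 * int n"
    by linarith
  then show "coeff_minus (k - 2 * int n - 2) * coeff_minus_iter k (Suc n) = coeff_minus_iter k (Suc (Suc n))"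
    by cases (simp_all add: coeff_minus_def coeff_minus_iter_def mon_mult mon_eq_iff div_mod_2)
qed

lemma U_X: "U n * X k = X (k + 2 * int n) * coeff_plus_iter k n + X (k - 2 * int n) * coeff_minus_iter k n"
proof -
  have "U n * X k = X (k + 2 * int n) * coeff_plus_iter k n + X (k - 2 * int n) * coeff_minus_iter k n \<and>
    U (Suc n) * X k = X (k + 2 * int (Suc n)) * coeff_plus_iter k (Suc n) + X (k - 2 * int (Suc n)) * coeff_minus_iter k (Suc n)"
  proof (induction n)
    case 0
    then show ?case
      using recurrence[of k] by (simp add: coeff_iter_zero coeff_iter_one U_def mult_2)
  next
    case (Suc n)
    let ?a = "k + 2 * int n + 2" and ?b = "k - 2 * int n - 2"
    have a: "u * X ?a = X (?a + 2) * coeff_plus ?a + X (k + 2 * int n) * coeff_minus ?a"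
      and b: "u * X ?b = X (k - 2 * int n) * coeff_plus ?b + X (?b - 2) * coeff_minus ?b"
      using recurrence[of ?a] recurrence[of ?b] by simp_all
    have "U (Suc (Suc n)) * X k = u * (X ?a * coeff_plus_iter k (Suc n) + X ?b * coeff_minus_iter k (Suc n)) -
        mon 0 1 1 1 * (X (k + 2 * int n) * coeff_plus_iter k n + X (k - 2 * int n) * coeff_minus_iter k n)"
      using Suc unfolding U_rec by (simp add: left_diff_distrib mult.assoc algebra_simps)
    also have "u * (X ?a * coeff_plus_iter k (Suc n) + X ?b * coeff_minus_iter k (Suc n)) =
        X (?a + 2) * coeff_plus_iter k (Suc (Suc n)) +
        X (k + 2 * int n) * (coeff_minus ?a * coeff_plus_iter k (Suc n)) + X (k - 2 * int n) * (coeff_plus ?b * coeff_minus_iter k (Suc n)) +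
        X (?b - 2) * coeff_minus_iter k (Suc (Suc n))"
      unfolding coeff_plus_mult_iter(1)[symmetric] coeff_minus_mult_iter(2)[symmetric] distrib_left mult.assoc[symmetric] a b
      by (simp add: distrib_right mult.assoc)
    \<comment> \<open>The subtracted term of the recursion equals the two inner terms, so only the
      outer ones survive.\<close>
    also have "mon 0 1 1 1 * (X (k + 2 * int n) * coeff_plus_iter k n + X (k - 2 * int n) * coeff_minus_iter k n) =
        X (k + 2 * int n) * (coeff_minus ?a * coeff_plus_iter k (Suc n)) + X (k - 2 * int n) * (coeff_plus ?b * coeff_minus_iter k (Suc n))"
      unfolding coeff_plus_mult_iter(2) coeff_minus_mult_iter(1) distrib_left mult.assoc[symmetric] mon_X by (simp add: mult.assoc)
    finally have "U (Suc (Suc n)) * X k = X (?a + 2) * coeff_plus_iter k (Suc (Suc n)) + X (?b - 2) * coeff_minus_iter k (Suc (Suc n))"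
      by simp
    then show ?case using Suc by (simp add: algebra_simps)
  qed
  then show ?thesis ..
qed


subsection \<open>Membership in the cluster algebra\<close>

abbreviation A :: "'f set" where "A \<equiv> cluster_algebra \<iota>"

lemma diff_in_algebra: "a \<in> A \<Longrightarrow> b \<in> A \<Longrightarrow> a - b \<in> A"
  using cluster_algebra.add[OF _ cluster_algebra.uminus] by fastforce

lemma power_in_algebra: "a \<in> A \<Longrightarrow> a ^ n \<in> A"
  by (induction n) (auto intro: cluster_algebra.one cluster_algebra.mult)

lemma powi_in_algebra: "a \<in> A \<Longrightarrow> inverse a \<in> A \<Longrightarrow> a powi n \<in> A"
  by (simp add: power_int_def power_in_algebra)

lemma mon_in_algebra: "mon e a b c \<in> A"
proof -
  \<comment> \<open>The added ab + ac + bc undoes the power of q produced by ordering the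
    y_j.\<close>
  have "mon e a b c = mon 1 0 0 0 powi (e + a * b + a * c + b * c) * mon 0 1 0 0 powi a * mon 0 0 1 0 powi b * mon 0 0 0 1 powi c"
    by (simp add: mon_powi mon_mult)
  moreover have "mon 1 0 0 0 powi n \<in> A" "mon 0 1 0 0 powi n \<in> A" "mon 0 0 1 0 powi n \<in> A" "mon 0 0 0 1 powi n \<in> A" for n
    using powi_in_algebra cluster_algebra.q[of \<iota>] cluster_algebra.q_inv[of \<iota>] cluster_algebra.y[of 1 \<iota>] cluster_algebra.y_inv[of 1 \<iota>]
      cluster_algebra.y[of 2 \<iota>] cluster_algebra.y_inv[of 2 \<iota>] cluster_algebra.y[of 3 \<iota>] cluster_algebra.y_inv[of 3 \<iota>]
    by (simp_all add: sqrt_q_mon yvar_mon)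
  ultimately show ?thesis
    by (metis cluster_algebra.mult)
qed

lemma clus_in_algebra: "s \<in> quantum_seeds \<iota> \<Longrightarrow> i \<in> {1, 2, 3} \<Longrightarrow> clus s i \<in> A"
  by (rule cluster_algebra.var) (auto simp: cluster_variables_def)

abbreviation mu :: "nat \<Rightarrow> 'f qseed \<Rightarrow> 'f qseed" where "mu \<equiv> mutate (sqrt_q \<iota>)"

lemma initial_clus:
  "clus (initial_seed \<iota>) 1 = X 1" "clus (initial_seed \<iota>) 2 = X 2" "clus (initial_seed \<iota>) 3 = X 3"
  using clus_Sigma[of 1] by (simp_all add: Sigma_seed_def)

lemma X_initial_in_algebra: "X 0 \<in> A" "X 1 \<in> A" "X 2 \<in> A" "X 3 \<in> A"
proof -
  have "Sigma_seed \<iota> 0 = seed_down (sqrt_q \<iota>) (initial_seed \<iota>)"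
    using Sigma_seed_down[of 1] by (simp add: Sigma_seed_def)
  then have "X 0 = clus (mu 3 (initial_seed \<iota>)) 3"
    by (simp add: Xvar_def seed_down_def reorder_def)
  then show "X 0 \<in> A"
    using clus_in_algebra[OF quantum_seeds.mutation[OF quantum_seeds.initial, of 3], of 3] by simp
  show "X 1 \<in> A" "X 2 \<in> A" "X 3 \<in> A"
    using clus_in_algebra[OF quantum_seeds.initial, of 1] clus_in_algebra[OF quantum_seeds.initial, of 2]
      clus_in_algebra[OF quantum_seeds.initial, of 3] unfolding initial_clus by simp_all
qed

lemma inverse_X: "inverse (\<iota> (Tor 0 0 1 0 0 0 0)) = \<iota> (Tor 0 0 (-1) 0 0 0 0)"
  "inverse (\<iota> (Tor 0 0 0 1 0 0 0)) = \<iota> (Tor 0 0 0 (-1) 0 0 0)"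
  by (rule inverse_unique, simp add: Tor_mult emb_one flip: emb_mult one_Tor)+

lemma ppart_simps: "ppart 0 = 0" "ppart 1 = 1" "ppart (- 1) = 0"
  by (simp_all add: ppart_def)

text \<open>\<open>w\<close> and \<open>z\<close> are the cluster variables that arise from \<open>\<Sigma>\<^sub>1\<close> by mutation in direction 2, and in
  direction 1 followed by 3.\<close>

lemma w_in_algebra: "\<iota> w_elt \<in> A"
proof -
  have f: "form_shape (initial_seed \<iota>) (G_mat 1)"
    using seed_shape_form[OF Sigma_shape_one(1)] by (simp add: Sigma_seed_def)
  note t = toric_seed[OF f, unfolded initial_clus, OF X_hom X_hom X_hom X_nonzero X_nonzero X_nonzero]
  have "clus (mu 2 (initial_seed \<iota>)) 2 =
      toric (sqrt_q \<iota>) (form (initial_seed \<iota>)) (clus (initial_seed \<iota>)) (\<lambda>i. (if i = 2 then -1 else 0) + ppart (Btilde i 2)) +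
      toric (sqrt_q \<iota>) (form (initial_seed \<iota>)) (clus (initial_seed \<iota>)) (\<lambda>i. (if i = 2 then -1 else 0) + ppart (- Btilde i 2))"
    by (simp add: mutate_def mut_clus_def initial_seed_def)
  also have "\<dots> = \<iota> w_elt"
    unfolding t
    by (simp add: Btilde_def ppart_simps power_int_minus inverse_X X_initial G_mat_def g_vec_def mon_def Tor_mult
        w_elt_def qX_Tor flip: emb_mult emb_add)
  finally show ?thesis
    using clus_in_algebra[OF quantum_seeds.mutation[OF quantum_seeds.initial, of 2], of 2] by simp
qed

lemma z_in_algebra: "\<iota> z_elt \<in> A"
proof -
  define s where "s = mu 1 (initial_seed \<iota>)"
  \<comment> \<open>Without reordering, the new variable X_4 occupies position 1.\<close>
  define G where "G = (\<lambda>i. g_vec (if i = (1::nat) then 4 else int i))"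
  have "Sigma_seed \<iota> 2 = seed_up (sqrt_q \<iota>) (initial_seed \<iota>)"
    using Sigma_seed_up[of 1] by (simp add: Sigma_seed_def)
  then have c: "clus s 1 = X 4" "clus s 2 = X 2" "clus s 3 = X 3"
    using clus_Sigma[of 2] by (simp_all add: seed_up_def reorder_def s_def)
  have f: "form_shape s G"
    unfolding form_shape_def s_def G_def
    by (simp add: mutate_def initial_seed_def mut_form_eq lam_def Btilde_def ppart_simps g_vec_def
        atLeastAtMost_1_6 mut_clus_def yvar_def)
  note t = toric_seed[OF f, unfolded c, OF X_hom X_hom X_hom X_nonzero X_nonzero X_nonzero]
  have "clus (mu 3 s) 3 =
      toric (sqrt_q \<iota>) (form s) (clus s) (\<lambda>i. (if i = 3 then -1 else 0) + ppart (exch s i 3)) +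
      toric (sqrt_q \<iota>) (form s) (clus s) (\<lambda>i. (if i = 3 then -1 else 0) + ppart (- exch s i 3))"
    by (simp add: mutate_def mut_clus_def)
  also have "\<dots> = \<iota> z_elt"
    unfolding t
    by (simp add: s_def mutate_def initial_seed_def mut_exch_def Btilde_def ppart_simps power_int_minus inverse_X
        X_initial X_4 G_def g_vec_def mon_def Tor_mult distrib_right z_elt_def qX_Tor add_ac flip: emb_mult emb_add)
  finally show ?thesis
    using clus_in_algebra[OF quantum_seeds.mutation[OF quantum_seeds.mutation[OF quantum_seeds.initial, of 1], of 3], of 3]
    by (simp add: s_def)
qed

lemma u_in_algebra: "u \<in> A"
proof -
  have "u = \<iota> w_elt * \<iota> z_elt - mon (-1) 1 0 1 - mon 1 0 1 0"
    by (simp add: u1_elt_def mon_def qX_Tor qhalf_Tor Tor_mult flip: emb_mult emb_diff)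
  then show ?thesis
    by (metis w_in_algebra z_in_algebra mon_in_algebra diff_in_algebra cluster_algebra.mult)
qed

lemma U_in_algebra: "U n \<in> A"
proof -
  have "U n \<in> A \<and> U (Suc n) \<in> A"
  proof (induction n)
    case 0
    then show ?case
      using u_in_algebra cluster_algebra.add[OF cluster_algebra.one cluster_algebra.one] by (simp add: U_def)
  next
    case (Suc n)
    then show ?case unfolding U_rec by (auto intro: diff_in_algebra cluster_algebra.mult u_in_algebra mon_in_algebra)
  qed
  then show ?thesis ..
qed

lemma coeff_plus_in_algebra: "coeff_plus k \<in> A" and coeff_minus_in_algebra: "coeff_minus k \<in> A"
  by (auto simp: coeff_plus_def coeff_minus_def mon_in_algebra intro: cluster_algebra.one)

text \<open>The Sigma_m are reordered seeds, while \<open>quantum_seeds\<close> contains unreordered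
  ones. So membership is read off from the recurrence for u_1, solved for an outer variable; the
  coefficient there is an invertible monomial.\<close>

lemma X_in_algebra: "X k \<in> A"
\<comment> \<open>The measure is twice the distance to 3/2, the centre of the four starting indices
  0, ..., 3; it decreases for k - 2, k - 4 from above and for k + 2, k + 4 from below.\<close>
proof (induction "nat \<bar>2 * k - 3\<bar>" arbitrary: k rule: less_induct)
  case less
  consider "4 \<le> k" | "k \<le> - 1" | "k \<in> {0, 1, 2, 3}" by fastforce
  then show ?case
  proof cases
    case 1
    then have "X k = u * X (k - 2) - X (k - 4) * coeff_minus (k - 2)"
      using recurrence[of "k - 2"] by (simp add: coeff_plus_def)
    moreover have "X (k - 2) \<in> A" "X (k - 4) \<in> A"
      using 1 by (auto intro!: less)
    ultimately show ?thesis
      by (auto intro: diff_in_algebra cluster_algebra.mult u_in_algebra coeff_minus_in_algebra)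
  next
    case 2
    have "X k * coeff_minus (k + 2) = u * X (k + 2) - X (k + 4) * coeff_plus (k + 2)"
      using recurrence[of "k + 2"] by (simp add: add.commute)
    moreover obtain e a b c where "coeff_minus (k + 2) = mon e a b c"
      using mon_one by (metis coeff_minus_def)
    ultimately have "X k = (u * X (k + 2) - X (k + 4) * coeff_plus (k + 2)) * mon (- e) (- a) (- b) (- c)"
      using mon_nonzero[of e a b c] by (metis inverse_mon mult.assoc mult.right_neutral right_inverse)
    moreover have "X (k + 2) \<in> A" "X (k + 4) \<in> A"
      using 2 by (auto intro!: less)
    ultimately show ?thesis
      by (auto intro!: diff_in_algebra cluster_algebra.mult u_in_algebra coeff_plus_in_algebra mon_in_algebra)
  qed (auto simp: X_initial_in_algebra)
qed

text \<open>Ordering the y_j accounts for all quadratic terms in the exponents of the theorem: what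
  is left is 2n, -2n, 1 or -1, as in the iterated coefficients.\<close>

lemma v_X_y: "sqrt_q \<iota> powi e * X k * yvar \<iota> 1 ^ a * yvar \<iota> 2 ^ b * yvar \<iota> 3 ^ c =
    X k * mon (e - int a * int b - int a * int c - int b * int c) (int a) (int b) (int c)"
proof -
  have y: "yvar \<iota> 1 ^ a = mon 0 (int a) 0 0" "yvar \<iota> 2 ^ b = mon 0 0 (int b) 0" "yvar \<iota> 3 ^ c = mon 0 0 0 (int c)"
    using mon_powi(2)[of "int a"] mon_powi(3)[of "int b"] mon_powi(4)[of "int c"] by (simp_all add: yvar_mon)
  show ?thesis
    unfolding y sqrt_q_mon mon_powi mon_X by (simp add: mult.assoc mon_mult g_shift_def algebra_simps)
qed

end

theorem theorem3p6:
  fixes \<iota> :: "qtorus \<Rightarrow> 'f::division_ring" and m n :: nat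
  assumes "skew_field_of_fractions \<iota>" and "0 < m" and "0 < n"
  defines "v \<equiv> sqrt_q \<iota>" and "y \<equiv> yvar \<iota>" and "X \<equiv> Xvar \<iota>" and "u \<equiv> \<lambda>n. \<iota> (u_elt n)"
    and "M \<equiv> int m" and "N \<equiv> int n"
  shows
    "u n \<in> cluster_algebra \<iota> \<and> (\<forall>k. X k \<in> cluster_algebra \<iota>) \<and>
     (M \<ge> 2*N + 1 \<longrightarrow>
        u n * X M = v powi (3*N^2 + 2*N) * X (M - 2*N) * y 1 ^ n * y 2 ^ n * y 3 ^ n
                    + X (M + 2*N)) \<and>
     (1 \<le> 2*M - 1 \<and> 2*M - 1 \<le> 2*N \<longrightarrow>
        u n * X (2*M - 1) =
          v powi (3*M^2 - 4*M + 2) * X (2*M - 1 - 2*N) * y 1 ^ m * y 2 ^ (m - 1) * y 3 ^ (m - 1)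
          + X (2*M - 1 + 2*N)) \<and>
     (1 \<le> 2*M \<and> 2*M \<le> 2*N \<longrightarrow>
        u n * X (2*M) =
          v powi (3*M^2 - 2*M + 1) * X (2*M - 2*N) * y 1 ^ m * y 2 ^ m * y 3 ^ (m - 1)
          + X (2*M + 2*N)) \<and>
     (M \<ge> 2*N \<longrightarrow>
        u n * X (- M) = v powi (3*N^2 - 2*N) * X (- M + 2*N) * y 1 ^ n * y 2 ^ n * y 3 ^ n
                        + X (- M - 2*N)) \<and>
     (0 \<le> 2*M - 1 \<and> 2*M - 1 \<le> 2*N - 1 \<longrightarrow>
        u n * X (- (2*M - 1)) =
          v powi (3*M^2 - 2*M - 1) * X (- (2*M - 1) + 2*N) * y 1 ^ (m - 1) * y 2 ^ m * y 3 ^ m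
          + X (- (2*M - 1) - 2*N)) \<and>
     (0 \<le> 2*M - 2 \<and> 2*M - 2 \<le> 2*N - 1 \<longrightarrow>
        u n * X (- (2*M - 2)) =
          v powi (3*M^2 - 4*M) * X (- (2*M - 2) + 2*N) * y 1 ^ (m - 1) * y 2 ^ (m - 1) * y 3 ^ m
          + X (- (2*M - 2) - 2*N))"
proof -
  interpret quantum_torus_embedding \<iota>
    by unfold_locales (rule assms(1))
  have u: "u n = U n"
    using \<open>0 < n\<close> by (simp add: u_def U_def)
  \<comment> \<open>Each of the six ranges selects one branch of the iterated coefficients, and one
    of the two coefficients is then 1.\<close>
  note UX = U_X[of n, folded N_def]
  have m: "int (m - Suc 0) = M - 1" "1 \<le> M" and n: "1 \<le> N"
    using assms(2,3) by (simp_all add: M_def N_def)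
  note ring = M_def[symmetric] N_def[symmetric] m power2_eq_square algebra_simps
  show ?thesis
  proof (intro conjI allI impI)
    show "u n \<in> cluster_algebra \<iota>" "X k \<in> cluster_algebra \<iota>" for k
      unfolding u X_def by (rule U_in_algebra X_in_algebra)+
  next
    assume k: "2 * N + 1 \<le> M"
    have "coeff_minus_iter M n = mon (2 * N) N N N" "coeff_plus_iter M n = 1"
      using k n by (simp_all add: coeff_minus_iter_def coeff_plus_iter_def N_def)
    then show "u n * X M = v powi (3*N^2 + 2*N) * X (M - 2*N) * y 1 ^ n * y 2 ^ n * y 3 ^ n + X (M + 2*N)"
      unfolding u v_def y_def X_def v_X_y UX by (simp add: ring)
  next
    assume k: "1 \<le> 2*M - 1 \<and> 2*M - 1 \<le> 2*N"
    have "coeff_minus_iter (2*M - 1) n = mon 1 M (M - 1) (M - 1)" "coeff_plus_iter (2*M - 1) n = 1"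
      using k by (simp_all add: coeff_minus_iter_def coeff_plus_iter_def div_mod_2 flip: N_def)
    then show "u n * X (2*M - 1) =
          v powi (3*M^2 - 4*M + 2) * X (2*M - 1 - 2*N) * y 1 ^ m * y 2 ^ (m - 1) * y 3 ^ (m - 1)
          + X (2*M - 1 + 2*N)"
      unfolding u v_def y_def X_def v_X_y UX by (simp add: ring)
  next
    assume k: "1 \<le> 2*M \<and> 2*M \<le> 2*N"
    have "coeff_minus_iter (2*M) n = mon 1 M M (M - 1)" "coeff_plus_iter (2*M) n = 1"
      using k by (simp_all add: coeff_minus_iter_def coeff_plus_iter_def div_mod_2 flip: N_def)
    then show "u n * X (2*M) =
          v powi (3*M^2 - 2*M + 1) * X (2*M - 2*N) * y 1 ^ m * y 2 ^ m * y 3 ^ (m - 1)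
          + X (2*M + 2*N)"
      unfolding u v_def y_def X_def v_X_y UX by (simp add: ring)
  next
    assume k: "2*N \<le> M"
    have "coeff_plus_iter (- M) n = mon (- 2 * N) N N N" "coeff_minus_iter (- M) n = 1"
      using k m by (simp_all add: coeff_minus_iter_def coeff_plus_iter_def flip: N_def)
    then show "u n * X (- M) = v powi (3*N^2 - 2*N) * X (- M + 2*N) * y 1 ^ n * y 2 ^ n * y 3 ^ n + X (- M - 2*N)"
      unfolding u v_def y_def X_def v_X_y UX by (simp add: ring)
  next
    assume k: "0 \<le> 2*M - 1 \<and> 2*M - 1 \<le> 2*N - 1"
    have "coeff_plus_iter (- (2*M - 1)) n = mon (- 1) (M - 1) M M" "coeff_minus_iter (- (2*M - 1)) n = 1"
      using k by (simp_all add: coeff_minus_iter_def coeff_plus_iter_def div_mod_2 flip: N_def)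
    then show "u n * X (- (2*M - 1)) =
          v powi (3*M^2 - 2*M - 1) * X (- (2*M - 1) + 2*N) * y 1 ^ (m - 1) * y 2 ^ m * y 3 ^ m
          + X (- (2*M - 1) - 2*N)"
      unfolding u v_def y_def X_def v_X_y UX by (simp add: ring)
  next
    assume k: "0 \<le> 2*M - 2 \<and> 2*M - 2 \<le> 2*N - 1"
    have "coeff_plus_iter (- (2*M - 2)) n = mon (- 1) (M - 1) (M - 1) M" "coeff_minus_iter (- (2*M - 2)) n = 1"
      using k by (simp_all add: coeff_minus_iter_def coeff_plus_iter_def div_mod_2 flip: N_def)
    then show "u n * X (- (2*M - 2)) =
          v powi (3*M^2 - 4*M) * X (- (2*M - 2) + 2*N) * y 1 ^ (m - 1) * y 2 ^ (m - 1) * y 3 ^ m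
          + X (- (2*M - 2) - 2*N)"
      unfolding u v_def y_def X_def v_X_y UX by (simp add: ring)
  qed
qed

end
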